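(* Let $\alpha>0$, $1\leq p<\infty$, and let $\mu$ be a nonnegative Borel measure on $\mathbb{C}^n$ satisfying the admissibility condition $\int_{\mathbb{C}^n}|K_w(z)|^2e^{-\alpha|w|^2}\,d\mu(w)<\infty$ for every $z\in\mathbb{C}^n$. Then the following statements are equivalent (in each of (ii)--(v), the condition for some value of the parameter and the condition for every value of the parameter are both equivalent to the others): (i) $T_\mu:\mathcal{F}_\alpha^p\to\mathcal{F}_\alpha^\infty$ is bounded; (ii) $\mu$ is a $(1,q)$ Fock--Carleson measure for some (or any) finite $q\geq p$; (iii) the function $z\mapsto\mu(D(z,\delta))$ belongs to $L^\infty(\mathbb{C}^n,dV)$ for some (or any) $\delta>0$; (iv) $\widetilde{\mu}_t\in L^\infty(\mathbb{C}^n,dV)$ for some (or any) $t>0$; (v) the sequence $(\mu(D(z_k,r)))_k$ belongs to $\ell^\infty$ for some (or any) $r>0$. Furthermore, in this case $$\|T_\mu\|\simeq\|I_\mu\|\simeq\|\widetilde{\mu}_t\|_{L^\infty}\simeq\|\mu(D(\cdot,\delta))\|_{L^\infty}\simeq\|\mu(D(z_k,r))\|_{\ell^\infty},$$ where $I_\mu$ is the embedding map $I_\mu:\mathcal{F}_\alpha^1\to L^1(\sigma_1)$.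
   Context: Fix $n\ge 1$ and $\alpha>0$. For $\langle z,w\rangle=\sum_{j=1}^n z_j\overline{w_j}$ and $|z|=\sqrt{\langle z,z\rangle}$ on $\mathbb{C}^n$, let $K_w(z)=e^{\alpha\langle z,w\rangle}$ and $k_w(z)=e^{\alpha\langle z,w\rangle-\alpha|w|^2/2}$. Let $dV$ be Lebesgue measure on $\mathbb{C}^n$ and $D(z,\delta)=\{w\in\mathbb{C}^n:|z-w|<\delta\}$. Fock spaces: for $1\le p<\infty$, $\mathcal{F}_\alpha^p$ is the space of entire functions $f$ on $\mathbb{C}^n$ with $\|f\|_{(p,\alpha)}^p=\left(\frac{\alpha p}{2\pi}\right)^n\int_{\mathbb{C}^n}|f(z)|^pe^{-\frac{\alpha p}{2}|z|^2}\,dV(z)<\infty$; $\mathcal{F}_\alpha^\infty$ is the space of entire functions $f$ with $\|f\|_{(\infty,\alpha)}=\sup_{z\in\mathbb{C}^n}|f(z)|e^{-\frac{\alpha}{2}|z|^2}<\infty$. Toeplitz operator: $T_\mu f(z)=\int_{\mathbb{C}^n}K_w(z)f(w)e^{-\alpha|w|^2}\,d\mu(w)$. It is bounded from one Fock space $X$ to another $Y$ if for every $f\in X$ the integral converges absolutely for every $z$, $T_\mu f\in Y$, and $\|T_\mu f\|_Y\le C\|f\|_X$ with $C$ independent of $f$; $\|T_\mu\|$ is the operator norm. Fock--Carleson measures: for $0<p\le\infty$ (with $\mathcal{F}_\alpha^p$ and $\|\cdot\|_{(p,\alpha)}$ given by the same formula when $0<p<1$) and $0<q<\infty$, $\mu$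 is a $(p,q)$ Fock--Carleson measure if there is a constant $C$ with $\int_{\mathbb{C}^n}|f(z)|^qe^{-\frac{\alpha q}{2}|z|^2}\,d\mu(z)\le C\|f\|_{(p,\alpha)}^q$ for all $f\in\mathcal{F}_\alpha^p$, i.e. the embedding map $I_\mu:\mathcal{F}_\alpha^p\to L^q(\sigma_q)$, $I_\mu f=f$, is bounded, where $d\sigma_q(z)=e^{-q\alpha|z|^2/2}\,d\mu(z)$. The $t$-Berezin transform of $\mu$, $t>0$, is $\widetilde{\mu}_t(w)=\int_{\mathbb{C}^n}|k_w(z)|^te^{-\frac{t\alpha}{2}|z|^2}\,d\mu(z)$. Lattice: for each $r>0$, $(z_k)$ denotes a fixed sequence in $\mathbb{C}^n$ (an $r/2$-lattice, depending on $r$) such that the balls $D(z_k,r/2)$ cover $\mathbb{C}^n$ and the balls $D(z_k,r/4)$ are mutually disjoint. $A\simeq B$ means $C^{-1}B\le A\le CB$ for some constant $C>0$; in norm estimates the constant does not depend on $\mu$ (it may depend on $n,\alpha,p,t,\delta,r$). *)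

theory Defs
  imports "HOL-Analysis.Analysis" "HOL-Probability.Essential_Supremum"
begin

text \<open>
  The space \<open>\<complex>\<^sup>n\<close> is the type \<^typ>\<open>complex^'n\<close> with \<open>n = CARD('n) \<ge> 1\<close>.  Its library norm is
  \<open>sqrt (\<Sum>j. |z\<^sub>j|\<^sup>2)\<close>, its open balls are \<open>D(z, \<delta>)\<close>, and \<^const>\<open>lborel\<close> is Lebesgue measure \<open>dV\<close> on
  it, viewed as \<open>\<real>\<^sup>2\<^sup>n\<close>.  The library inner product is only the real part of the Hermitian
  product, which is why the latter is defined here.
\<close>

definition hermitian :: "complex^'n \<Rightarrow> complex^'n \<Rightarrow> complex" where
  "hermitian z w = (\<Sum>j\<in>UNIV. z $ j * cnj (w $ j))"

definition fock_kernel :: "real \<Rightarrow> complex^'n \<Rightarrow> complex^'n \<Rightarrow> complex" where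
  "fock_kernel \<alpha> w z = exp (of_real \<alpha> * hermitian z w)"

definition normalized_fock_kernel :: "real \<Rightarrow> complex^'n \<Rightarrow> complex^'n \<Rightarrow> complex" where
  "normalized_fock_kernel \<alpha> w z =
     exp (of_real \<alpha> * hermitian z w - of_real (\<alpha> * (norm w)\<^sup>2 / 2))"

text \<open>Holomorphy in several variables: a complex-linear Frechet derivative exists at every point.\<close>

definition entire :: "(complex^'n \<Rightarrow> complex) \<Rightarrow> bool" where
  "entire f \<longleftrightarrow>
     (\<forall>z. \<exists>f'. (f has_derivative f') (at z) \<and> (\<forall>c v. f' (c *s v) = c * f' v))"


subsection \<open>Fock spaces\<close>

text \<open>The exponent \<open>p\<close> of a Fock space ranges over \<open>(0, \<infinity>]\<close> and is therefore an \<^typ>\<open>ennreal\<close>;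
  \<open>fock_integral \<alpha> s f\<close> is the \<open>s\<close>-th power of the norm for a finite exponent \<open>s\<close>.
  The real number \<open>fock_norm \<alpha> p f\<close> is meaningful only for \<open>f \<in> fock_space \<alpha> p\<close>.\<close>

definition fock_integral :: "real \<Rightarrow> real \<Rightarrow> (complex^'n \<Rightarrow> complex) \<Rightarrow> ennreal" where
  "fock_integral \<alpha> s f =
     ennreal ((\<alpha> * s / (2 * pi)) ^ CARD('n)) *
     (\<integral>\<^sup>+ z. ennreal (norm (f z) powr s * exp (- (\<alpha> * s / 2) * (norm z)\<^sup>2)) \<partial>lborel)"

definition fock_space :: "real \<Rightarrow> ennreal \<Rightarrow> (complex^'n \<Rightarrow> complex) set" where
  "fock_space \<alpha> p = {f. entire f \<and>
     (if p = \<infinity> then bdd_above (range (\<lambda>z. norm (f z) * exp (- (\<alpha> / 2) * (norm z)\<^sup>2)))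
      else fock_integral \<alpha> (enn2real p) f < \<infinity>)}"

definition fock_norm :: "real \<Rightarrow> ennreal \<Rightarrow> (complex^'n \<Rightarrow> complex) \<Rightarrow> real" where
  "fock_norm \<alpha> p f =
     (if p = \<infinity> then (SUP z. norm (f z) * exp (- (\<alpha> / 2) * (norm z)\<^sup>2))
      else enn2real (fock_integral \<alpha> (enn2real p) f) powr (1 / enn2real p))"

text \<open>Operator norm of a bounded operator \<open>T\<close> on a space \<open>X\<close> normed by \<open>nX\<close>, with target norm
  \<open>nY\<close>.\<close>

definition operator_norm ::
    "'a set \<Rightarrow> ('a \<Rightarrow> real) \<Rightarrow> ('b \<Rightarrow> real) \<Rightarrow> ('a \<Rightarrow> 'b) \<Rightarrow> ennreal" where
  "operator_norm X nX nY T = (SUP f\<in>{f \<in> X. nX f \<le> 1}. ennreal (nY (T f)))"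


subsection \<open>Toeplitz operators, Carleson measures and the Berezin transform\<close>

definition admissible :: "real \<Rightarrow> (complex^'n) measure \<Rightarrow> bool" where
  "admissible \<alpha> \<mu> \<longleftrightarrow>
     (\<forall>z. (\<integral>\<^sup>+ w. ennreal ((norm (fock_kernel \<alpha> w z))\<^sup>2 * exp (- \<alpha> * (norm w)\<^sup>2)) \<partial>\<mu>) < \<infinity>)"

definition toeplitz_integrand ::
    "real \<Rightarrow> (complex^'n \<Rightarrow> complex) \<Rightarrow> complex^'n \<Rightarrow> complex^'n \<Rightarrow> complex" where
  "toeplitz_integrand \<alpha> f z w = fock_kernel \<alpha> w z * f w * of_real (exp (- \<alpha> * (norm w)\<^sup>2))"

definition toeplitz ::
    "real \<Rightarrow> (complex^'n) measure \<Rightarrow> (complex^'n \<Rightarrow> complex) \<Rightarrow> complex^'n \<Rightarrow> complex" where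
  "toeplitz \<alpha> \<mu> f z = (\<integral> w. toeplitz_integrand \<alpha> f z w \<partial>\<mu>)"

definition toeplitz_bounded ::
    "real \<Rightarrow> ennreal \<Rightarrow> ennreal \<Rightarrow> (complex^'n) measure \<Rightarrow> bool" where
  "toeplitz_bounded \<alpha> p q \<mu> \<longleftrightarrow>
     (\<forall>f\<in>fock_space \<alpha> p.
        (\<forall>z. integrable \<mu> (toeplitz_integrand \<alpha> f z)) \<and> toeplitz \<alpha> \<mu> f \<in> fock_space \<alpha> q) \<and>
     (\<exists>C. \<forall>f\<in>fock_space \<alpha> p. fock_norm \<alpha> q (toeplitz \<alpha> \<mu> f) \<le> C * fock_norm \<alpha> p f)"

definition toeplitz_norm ::
    "real \<Rightarrow> ennreal \<Rightarrow> ennreal \<Rightarrow> (complex^'n) measure \<Rightarrow> ennreal" where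
  "toeplitz_norm \<alpha> p q \<mu> =
     operator_norm (fock_space \<alpha> p) (fock_norm \<alpha> p) (fock_norm \<alpha> q) (toeplitz \<alpha> \<mu>)"

definition fock_carleson ::
    "real \<Rightarrow> ennreal \<Rightarrow> real \<Rightarrow> (complex^'n) measure \<Rightarrow> bool" where
  "fock_carleson \<alpha> p q \<mu> \<longleftrightarrow>
     (\<exists>C. \<forall>f\<in>fock_space \<alpha> p.
        (\<integral>\<^sup>+ z. ennreal (norm (f z) powr q * exp (- (\<alpha> * q / 2) * (norm z)\<^sup>2)) \<partial>\<mu>)
          \<le> ennreal (C * fock_norm \<alpha> p f powr q))"

definition carleson_weighted ::
    "real \<Rightarrow> real \<Rightarrow> (complex^'n) measure \<Rightarrow> (complex^'n) measure" where
  "carleson_weighted \<alpha> q \<mu> = density \<mu> (\<lambda>z. ennreal (exp (- (q * \<alpha> / 2) * (norm z)\<^sup>2)))"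

definition Lp_norm :: "real \<Rightarrow> 'a measure \<Rightarrow> ('a \<Rightarrow> complex) \<Rightarrow> real" where
  "Lp_norm q M f = enn2real (\<integral>\<^sup>+ x. ennreal (norm (f x) powr q) \<partial>M) powr (1 / q)"

text \<open>The norm of the embedding of the Fock space of exponent \<open>p\<close> into \<open>L\<^sup>q(\<sigma>\<^sub>q)\<close>; meaningful only
  for a \<open>(p, q)\<close> Carleson measure, as \<^const>\<open>Lp_norm\<close> is real-valued.\<close>

definition embedding_norm ::
    "real \<Rightarrow> ennreal \<Rightarrow> real \<Rightarrow> (complex^'n) measure \<Rightarrow> ennreal" where
  "embedding_norm \<alpha> p q \<mu> =
     operator_norm (fock_space \<alpha> p) (fock_norm \<alpha> p) (Lp_norm q (carleson_weighted \<alpha> q \<mu>)) (\<lambda>f. f)"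

definition berezin :: "real \<Rightarrow> real \<Rightarrow> (complex^'n) measure \<Rightarrow> complex^'n \<Rightarrow> ennreal" where
  "berezin \<alpha> t \<mu> w =
     (\<integral>\<^sup>+ z. ennreal (norm (normalized_fock_kernel \<alpha> w z) powr t *
                     exp (- (t * \<alpha> / 2) * (norm z)\<^sup>2)) \<partial>\<mu>)"


subsection \<open>Norms, lattices and comparability\<close>

text \<open>For \<open>g \<ge> 0\<close>, \<open>g \<in> L\<^sup>\<infinity>(dV)\<close> means \<open>Linf_norm g < \<infinity>\<close>: the library's essential supremum of a
  non-measurable function is \<open>\<infinity>\<close>, so this includes measurability.  Likewise for \<open>\<ell>\<^sup>\<infinity>\<close>.\<close>

definition Linf_norm :: "(complex^'n \<Rightarrow> ennreal) \<Rightarrow> ennreal" where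
  "Linf_norm g = esssup lborel g"

definition linf_norm :: "(nat \<Rightarrow> ennreal) \<Rightarrow> ennreal" where
  "linf_norm a = (SUP k. a k)"

definition half_lattice :: "real \<Rightarrow> (nat \<Rightarrow> complex^'n) \<Rightarrow> bool" where
  "half_lattice r z \<longleftrightarrow>
     (\<Union>k. ball (z k) (r / 2)) = UNIV \<and> disjoint_family (\<lambda>k. ball (z k) (r / 4))"

definition comparable :: "real \<Rightarrow> ennreal \<Rightarrow> ennreal \<Rightarrow> bool" where
  "comparable C A B \<longleftrightarrow> A \<le> ennreal C * B \<and> B \<le> ennreal C * A"

end

theory Submission
  imports Defs "HOL-Complex_Analysis.Cauchy_Integral_Formula" "HOL-Probability.Distributions"
begin

text \<open>
  Every quantity in the theorem is compared with the single number
  \<open>S = sup\<^sub>z \<mu>(D(z, 1))\<close> (\<open>sup_ball_mass\<close>), with constants that do not depend on \<open>\<mu>\<close>.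

  The geometric conditions are handled by covering arguments.  A ball of any radius is covered by
  boundedly many balls of radius \<open>\<delta>/2\<close>, and a ball \<open>D(y, \<delta>/2)\<close> lies in \<open>D(u, \<delta>)\<close> for all \<open>u\<close> near
  \<open>y\<close>, a set of positive Lebesgue measure, so even the essential supremum of \<open>\<mu>(D(\<cdot>, \<delta>))\<close> controls
  the mass of all balls (\<open>emeasure_ball_le_Linf_norm\<close>).  The balls \<open>D(z\<^sub>k, r/2)\<close>
  cover the space, so each ball of radius \<open>r/2\<close> lies in one of the balls \<open>D(z\<^sub>k, r)\<close>.

  The analytic conditions are handled through one identity, \<open>weighted_modulus_kernel\<close>: with the
  Gaussian weight included, \<open>|k\<^sub>w(z)|\<close> equals \<open>exp (- \<alpha> |z - w|\<^sup>2 / 2)\<close>.  Hence the Berezin transform is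
  a Gaussian average of \<open>\<mu>\<close>; it dominates the mass of balls pointwise, and it is dominated by \<open>S\<close>
  because a Gaussian at one point is bounded by the mean over a unit ball of a wider Gaussian, after
  which Tonelli's theorem replaces \<open>\<mu>\<close> by \<open>\<mu>(D(u, 1)) dV(u)\<close> (\<open>nn_integral_le_of_ball_mean\<close>).

  The same Tonelli argument gives the Carleson inequality, once a weighted holomorphic function is
  bounded by its mean over a unit ball (\<open>weighted_modulus_le_ball_mean\<close>).  That mean value inequality
  averages the one-variable Cauchy formula over all complex lines through the centre, using that
  Lebesgue measure is invariant under \<open>v \<mapsto> e\<^sup>i\<^sup>\<theta> v\<close>.  It also yields the embedding of each Fock space
  into the one of exponent \<open>\<infinity>\<close> (\<open>weighted_modulus_le_fock_norm\<close>), whence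
  \<open>|T\<^sub>\<mu> f(z)| exp (- \<alpha> |z|\<^sup>2 / 2)\<close> is at most a multiple of the norm of \<open>f\<close> times the Berezin
  transform at \<open>z\<close>.  The kernels \<open>k\<^sub>w\<close> have norm 1 in every Fock space and are the test functions for the
  converse: \<open>T\<^sub>\<mu> k\<^sub>w\<close> evaluated at \<open>w\<close> is the Berezin transform with parameter 2, and the Carleson integral
  of \<open>k\<^sub>w\<close> is the Berezin transform with parameter \<open>q\<close>.
\<close>

unbundle no fps_syntax

section \<open>Invariance of Lebesgue measure under orthogonal maps\<close>

lemma nn_integral_lborel_shift:
  fixes f :: "'a::euclidean_space \<Rightarrow> ennreal"
  assumes [measurable]: "f \<in> borel_measurable borel"
  shows "(\<integral>\<^sup>+x. f (x + a) \<partial>lborel) = (\<integral>\<^sup>+x. f x \<partial>lborel)"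
proof -
  have "(\<integral>\<^sup>+x. f x \<partial>lborel) = (\<integral>\<^sup>+x. f x \<partial>distr lborel borel ((+) a))"
    by (simp add: lborel_distr_plus)
  also have "\<dots> = (\<integral>\<^sup>+x. f (a + x) \<partial>lborel)"
    by (subst nn_integral_distr) auto
  finally show ?thesis
    by (simp add: add.commute)
qed

lemma nn_integral_lborel_reflect:
  fixes f :: "'a::euclidean_space \<Rightarrow> ennreal"
  assumes [measurable]: "f \<in> borel_measurable borel"
  shows "(\<integral>\<^sup>+x. f (a - x) \<partial>lborel) = (\<integral>\<^sup>+x. f x \<partial>lborel)"
proof -
  have "lborel = distr lborel borel (\<lambda>x::'a. a + (-1) *\<^sub>R x)"
    using lborel_affine[of "-1" a] by (simp add: density_1)
  then have "(\<integral>\<^sup>+x. f x \<partial>lborel) = (\<integral>\<^sup>+x. f x \<partial>distr lborel borel (\<lambda>x::'a. a + (-1) *\<^sub>R x))"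
    by simp
  also have "\<dots> = (\<integral>\<^sup>+x. f (a + (-1) *\<^sub>R x) \<partial>lborel)"
    by (subst nn_integral_distr) auto
  finally show ?thesis
    by simp
qed

text \<open>
  This is the uniqueness argument for Haar measure.  Since \<open>A \<mapsto> emeasure lborel (T -` A)\<close> is
  translation invariant, Tonelli's theorem for the indicator of \<open>T x \<in> A, T x + y \<in> B\<close> shows that it
  is proportional to Lebesgue measure, and the unit ball \<open>B\<close>, which \<open>T\<close> preserves, fixes the factor
  to be 1.
\<close>

lemma emeasure_lborel_orthogonal_vimage:
  fixes T :: "'a::euclidean_space \<Rightarrow> 'a"
  assumes T: "orthogonal_transformation T" and A[measurable]: "A \<in> sets borel"
  shows "emeasure lborel (T -` A) = emeasure lborel A"
proof -
  have lin: "linear T"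
    by (rule orthogonal_transformation_linear[OF T])
  have meas[measurable]: "T \<in> borel \<rightarrow>\<^sub>M borel"
    using lin by (intro borel_measurable_continuous_onI linear_continuous_on) (simp add: linear_conv_bounded_linear)
  define B where "B = ball (0::'a) 1"
  have B[measurable]: "B \<in> sets borel"
    by (simp add: B_def)
  have BT: "T -` B = B"
    using orthogonal_transformation_norm[OF T] by (auto simp: B_def)
  have ind: "(\<integral>\<^sup>+x. indicator S (T x) \<partial>lborel) = emeasure lborel (T -` S)"
    if [measurable]: "S \<in> sets borel" for S
  proof -
    have "T -` S \<in> sets borel"
      using measurable_sets[OF meas that] by simp
    moreover have "(\<lambda>x. indicator S (T x)) = (indicator (T -` S) :: 'a \<Rightarrow> ennreal)"
      by (auto simp: indicator_def)
    ultimately show ?thesis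
      by simp
  qed
  have "emeasure lborel (T -` A) * emeasure lborel B
      = (\<integral>\<^sup>+x. indicator A (T x) * emeasure lborel B \<partial>lborel)"
    by (subst nn_integral_multc) (simp_all add: ind)
  also have "\<dots> = (\<integral>\<^sup>+x. (\<integral>\<^sup>+y. indicator A (T x) * indicator B (y + T x) \<partial>lborel) \<partial>lborel)"
    by (subst nn_integral_cmult, simp_all add: nn_integral_lborel_shift)
  also have "\<dots> = (\<integral>\<^sup>+y. (\<integral>\<^sup>+x. indicator A (T x) * indicator B (y + T x) \<partial>lborel) \<partial>lborel)"
    by (rule lborel_pair.Fubini'[symmetric]) measurable
  also have "\<dots> = (\<integral>\<^sup>+y. (\<integral>\<^sup>+x. indicator A (T x - y) * indicator B (T x) \<partial>lborel) \<partial>lborel)"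
  proof (rule nn_integral_cong)
    fix y :: 'a
    obtain b where b: "y = T b"
      using orthogonal_transformation_surj[OF T] by (metis surjD)
    have "(\<integral>\<^sup>+x. indicator A (T x - y) * indicator B (T x) \<partial>lborel)
       = (\<integral>\<^sup>+x. indicator A (T (x + b) - y) * indicator B (T (x + b)) \<partial>lborel)"
      by (subst nn_integral_lborel_shift[of "\<lambda>x. indicator A (T x - y) * indicator B (T x)" b]) auto
    then show "(\<integral>\<^sup>+x. indicator A (T x) * indicator B (y + T x) \<partial>lborel)
       = (\<integral>\<^sup>+x. indicator A (T x - y) * indicator B (T x) \<partial>lborel)"
      by (simp add: linear_add[OF lin] b add.commute)
  qed
  also have "\<dots> = (\<integral>\<^sup>+x. (\<integral>\<^sup>+y. indicator A (T x - y) * indicator B (T x) \<partial>lborel) \<partial>lborel)"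
    by (rule lborel_pair.Fubini') measurable
  also have "\<dots> = (\<integral>\<^sup>+x. emeasure lborel A * indicator B (T x) \<partial>lborel)"
    by (subst nn_integral_multc, simp_all add: nn_integral_lborel_reflect)
  also have "\<dots> = emeasure lborel A * emeasure lborel (T -` B)"
    by (subst nn_integral_cmult) (simp_all add: ind)
  finally have "emeasure lborel (T -` A) * emeasure lborel B = emeasure lborel A * emeasure lborel B"
    by (simp add: BT)
  moreover have "unit_ball_vol (real DIM('a)) \<noteq> 0"
    using unit_ball_vol_pos[of "real DIM('a)"] by linarith
  then have "emeasure lborel B \<noteq> 0" "emeasure lborel B \<noteq> \<infinity>"
    by (auto simp: B_def emeasure_ball)
  ultimately show ?thesis
    by (simp add: mult.commute[of _ "emeasure lborel B"] ennreal_mult_cancel_left)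
qed


lemma nn_integral_lborel_orthogonal:
  fixes T :: "'a::euclidean_space \<Rightarrow> 'a"
  assumes T: "orthogonal_transformation T" and [measurable]: "f \<in> borel_measurable borel"
  shows "(\<integral>\<^sup>+x. f (T x) \<partial>lborel) = (\<integral>\<^sup>+x. f x \<partial>lborel)"
proof -
  have [measurable]: "T \<in> borel \<rightarrow>\<^sub>M borel"
    using orthogonal_transformation_linear[OF T]
    by (intro borel_measurable_continuous_onI linear_continuous_on) (simp add: linear_conv_bounded_linear)
  have "distr lborel borel T = lborel"
    using emeasure_lborel_orthogonal_vimage[OF T] by (intro measure_eqI) (auto simp: emeasure_distr)
  then have "(\<integral>\<^sup>+x. f x \<partial>lborel) = (\<integral>\<^sup>+x. f x \<partial>distr lborel borel T)"
    by simp
  also have "\<dots> = (\<integral>\<^sup>+x. f (T x) \<partial>lborel)"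
    by (subst nn_integral_distr) auto
  finally show ?thesis ..
qed

section \<open>The Hermitian product\<close>

lemma norm_vector_scalar_mult: "norm (c *s v) = norm c * norm v" for v :: "complex^'n"
  by (simp add: norm_vec_def norm_mult L2_set_right_distrib)

lemma continuous_on_vector_scalar_mult [continuous_intros]:
  fixes g :: "'a::topological_space \<Rightarrow> complex^'n"
  assumes "continuous_on S f" "continuous_on S g"
  shows "continuous_on S (\<lambda>x. f x *s g x)"
  unfolding vector_scalar_mult_def using assms by (intro continuous_intros)

lemma Re_hermitian: "Re (hermitian z w) = z \<bullet> w"
  by (simp add: hermitian_def inner_vec_def inner_complex_def)

lemma norm_hermitian_le: "norm (hermitian z w) \<le> norm z * norm w"
proof -
  have "norm (hermitian z w) \<le> (\<Sum>j\<in>UNIV. \<bar>norm (z $ j)\<bar> * \<bar>norm (w $ j)\<bar>)"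
    unfolding hermitian_def by (rule order_trans[OF norm_sum]) (simp add: norm_mult)
  also have "\<dots> \<le> norm z * norm w"
    unfolding norm_vec_def by (rule L2_set_mult_ineq)
  finally show ?thesis .
qed

lemma hermitian_cnj: "hermitian w z = cnj (hermitian z w)"
  by (simp add: hermitian_def mult.commute)

lemma hermitian_add_left: "hermitian (a + b) w = hermitian a w + hermitian b w"
  by (simp add: hermitian_def sum.distrib distrib_right)

lemma hermitian_scale_left: "hermitian (c *s a) w = c * hermitian a w"
  by (simp add: hermitian_def sum_distrib_left mult.assoc)

lemma hermitian_zero_left [simp]: "hermitian 0 w = 0"
  by (simp add: hermitian_def)

lemma scaleR_conv_scale: "r *\<^sub>R a = of_real r *s a" for a :: "complex^'n"
  by (simp add: vec_eq_iff scaleR_conv_of_real[where 'a=complex])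

lemma bounded_linear_hermitian: "bounded_linear (\<lambda>a. hermitian a w)"
proof (rule bounded_linear_intro[where K = "norm w"])
  show "hermitian (r *\<^sub>R a) w = r *\<^sub>R hermitian a w" for r a
    by (simp only: scaleR_conv_scale hermitian_scale_left scaleR_conv_of_real[where 'a=complex])
qed (simp_all add: hermitian_add_left norm_hermitian_le)

lemma continuous_on_hermitian [continuous_intros]:
  assumes "continuous_on S f" "continuous_on S g"
  shows "continuous_on S (\<lambda>x. hermitian (f x) (g x))"
  unfolding hermitian_def using assms by (intro continuous_intros)

section \<open>The mean value inequality on balls\<close>

lemma circle_mean_value:
  assumes "h holomorphic_on UNIV"
  shows "((\<lambda>t. h (exp (2 * of_real pi * \<i> * of_real t))) has_integral h 0) {0..1}"
proof -
  have "((\<lambda>u. h u / (u - 0)) has_contour_integral (2 * of_real pi * \<i> * h 0)) (circlepath 0 1)"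
    using assms by (intro Cauchy_integral_circlepath_simple) (auto intro: holomorphic_on_subset)
  then have "((\<lambda>t. h (circlepath 0 1 t) / circlepath 0 1 t
      * vector_derivative (circlepath 0 1) (at t within {0..1})) has_integral (2 * of_real pi * \<i> * h 0)) {0..1}"
    by (simp add: has_contour_integral_def)
  then have "((\<lambda>t. (2 * of_real pi * \<i>) * h (exp (2 * of_real pi * \<i> * of_real t)))
      has_integral (2 * of_real pi * \<i> * h 0)) {0..1}"
    by (rule has_integral_eq[rotated]) (simp add: vector_derivative_circlepath01, simp add: circlepath)
  from has_integral_mult_right[OF this, of "1 / (2 * of_real pi * \<i>)"] show ?thesis
    by simp
qed

lemma norm_center_le_circle_mean:
  assumes h: "h holomorphic_on UNIV"
  shows "ennreal (norm (h 0))
    \<le> (\<integral>\<^sup>+t. indicator {0..1::real} t * ennreal (norm (h (exp (2 * of_real pi * \<i> * of_real t)))) \<partial>lborel)"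
proof -
  let ?H = "\<lambda>t::real. h (exp (2 * of_real pi * \<i> * of_real t))"
  have cont: "continuous_on {0..1} ?H"
    by (rule continuous_on_compose2[OF holomorphic_on_imp_continuous_on[OF h]]) (auto intro!: continuous_intros)
  have int: "(\<lambda>t. norm (?H t)) integrable_on {0..1}"
    by (intro integrable_continuous_interval continuous_intros cont)
  have "norm (h 0) \<le> integral {0..1} (\<lambda>t. norm (?H t))"
    using circle_mean_value[OF h] int
    by (metis (no_types, lifting) has_integral_integrable integral_norm_bound_integral integral_unique order_refl)
  moreover have "(\<integral>\<^sup>+t. ennreal (indicator {0..1} t * norm (?H t)) \<partial>lborel) = ennreal (integral {0..1} (\<lambda>t. norm (?H t)))"
    using int by (intro nn_integral_has_integral_lebesgue) (auto simp: integrable_integral)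
  ultimately show ?thesis
    by (simp add: ennreal_mult'' ennreal_indicator ennreal_leI)
qed

text \<open>
  On each complex line the value at the centre is at most a circle average.  Integrating over the
  ball and exchanging the order of integration leaves, for each angle, the integral of the rotated
  function, which the rotation invariance of Lebesgue measure makes independent of the angle.
\<close>

lemma norm_center_le_ball_mean:
  fixes G :: "complex^'n \<Rightarrow> complex"
  assumes cont: "continuous_on UNIV G" and hol: "\<And>v. (\<lambda>\<zeta>. G (\<zeta> *s v)) holomorphic_on UNIV"
  shows "ennreal (norm (G 0)) * emeasure lborel (ball (0 :: complex^'n) 1)
    \<le> (\<integral>\<^sup>+v. indicator (ball 0 1) v * ennreal (norm (G v)) \<partial>lborel)"
proof -
  let ?e = "\<lambda>t::real. exp (2 * of_real pi * \<i> * of_real t) :: complex"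
  let ?B = "ball (0 :: complex^'n) 1"
  have norm_e: "norm (?e t) = 1" for t
    by simp
  have orth: "orthogonal_transformation (\<lambda>v :: complex^'n. ?e t *s v)" for t
    unfolding orthogonal_transformation
    by (auto intro!: linearI simp: norm_vector_scalar_mult norm_e vec_eq_iff algebra_simps)
  have [measurable]: "G \<in> borel_measurable borel"
    by (rule borel_measurable_continuous_onI[OF cont])
  have [measurable]: "?B \<in> sets borel"
    by simp
  let ?H = "\<lambda>v. indicator ?B v * ennreal (norm (G v))"
  have H [measurable]: "?H \<in> borel_measurable borel"
    by measurable
  have R: "(\<lambda>p. ?e (snd p) *s fst p) \<in> (lborel \<Otimes>\<^sub>M lborel) \<rightarrow>\<^sub>M (borel :: (complex^'n) measure)"
    unfolding lborel_prod measurable_lborel2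
    by (intro borel_measurable_continuous_onI) (auto intro!: continuous_intros)
  have meas: "(\<lambda>(v, t). indicator {0..1::real} t * ?H (?e t *s v)) \<in> borel_measurable (lborel \<Otimes>\<^sub>M lborel)"
    using measurable_compose[OF R H] by (simp add: case_prod_beta)
  have "ennreal (norm (G 0)) * emeasure lborel ?B = (\<integral>\<^sup>+v. indicator ?B v * ennreal (norm (G 0)) \<partial>lborel)"
    by (subst nn_integral_multc) (auto simp: mult.commute intro!: borel_measurable_indicator)
  also have "\<dots> = (\<integral>\<^sup>+v. indicator ?B v * ennreal (norm (G (0 *s v))) \<partial>lborel)"
    by (simp add: vector_smult_lzero)
  also have "\<dots> \<le> (\<integral>\<^sup>+v. indicator ?B v * (\<integral>\<^sup>+t. indicator {0..1} t * ennreal (norm (G (?e t *s v))) \<partial>lborel) \<partial>lborel)"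
    by (intro nn_integral_mono mult_left_mono norm_center_le_circle_mean[OF hol]) auto
  \<comment> \<open>The rotation is also inserted into the indicator, which it does not change, so that the whole
    integrand becomes a function of the rotated variable.\<close>
  also have "\<dots> = (\<integral>\<^sup>+v. (\<integral>\<^sup>+t. indicator {0..1} t * (indicator ?B (?e t *s v) * ennreal (norm (G (?e t *s v)))) \<partial>lborel) \<partial>lborel)"
  proof (rule nn_integral_cong)
    fix v :: "complex^'n"
    have [measurable]: "(\<lambda>t. G (?e t *s v)) \<in> borel_measurable borel"
      by (intro borel_measurable_continuous_onI continuous_on_compose2[OF cont]) (auto intro!: continuous_intros)
    have "indicator ?B (?e t *s v) = (indicator ?B v :: ennreal)" for t
      by (auto simp: indicator_def norm_vector_scalar_mult norm_e)
    then have "(\<integral>\<^sup>+t. indicator {0..1} t * (indicator ?B (?e t *s v) * ennreal (norm (G (?e t *s v)))) \<partial>lborel)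
      = (\<integral>\<^sup>+t. indicator ?B v * (indicator {0..1} t * ennreal (norm (G (?e t *s v)))) \<partial>lborel)"
      by (simp only: mult_ac)
    also have "\<dots> = indicator ?B v * (\<integral>\<^sup>+t. indicator {0..1} t * ennreal (norm (G (?e t *s v))) \<partial>lborel)"
      by (rule nn_integral_cmult) measurable
    finally show "indicator ?B v * (\<integral>\<^sup>+t. indicator {0..1} t * ennreal (norm (G (?e t *s v))) \<partial>lborel)
      = (\<integral>\<^sup>+t. indicator {0..1} t * (indicator ?B (?e t *s v) * ennreal (norm (G (?e t *s v)))) \<partial>lborel)" ..
  qed
  also have "\<dots> = (\<integral>\<^sup>+t. (\<integral>\<^sup>+v. indicator {0..1} t * (indicator ?B (?e t *s v) * ennreal (norm (G (?e t *s v)))) \<partial>lborel) \<partial>lborel)"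
    by (rule lborel_pair.Fubini'[symmetric, OF meas])
  also have "\<dots> = (\<integral>\<^sup>+t. indicator {0..1::real} t * (\<integral>\<^sup>+v. indicator ?B v * ennreal (norm (G v)) \<partial>lborel) \<partial>lborel)"
  proof (rule nn_integral_cong)
    fix t :: real
    have "(\<integral>\<^sup>+v. indicator ?B (?e t *s v) * ennreal (norm (G (?e t *s v))) \<partial>lborel)
      = (\<integral>\<^sup>+v. indicator ?B v * ennreal (norm (G v)) \<partial>lborel)"
      by (rule nn_integral_lborel_orthogonal[OF orth H])
    then show "(\<integral>\<^sup>+v. indicator {0..1} t * (indicator ?B (?e t *s v) * ennreal (norm (G (?e t *s v)))) \<partial>lborel)
      = indicator {0..1} t * (\<integral>\<^sup>+v. indicator ?B v * ennreal (norm (G v)) \<partial>lborel)"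
      by (auto simp: indicator_def)
  qed
  also have "\<dots> = (\<integral>\<^sup>+v. indicator ?B v * ennreal (norm (G v)) \<partial>lborel)"
    by (subst nn_integral_multc) auto
  finally show ?thesis .
qed

section \<open>Weighted moduli and pointwise bounds in Fock spaces\<close>

declare borel_open[OF open_ball, measurable]

lemma entire_imp_continuous: "entire f \<Longrightarrow> continuous_on UNIV f"
  unfolding entire_def continuous_on_eq_continuous_at[OF open_UNIV]
  by (metis has_derivative_continuous)

lemma entire_imp_measurable: "entire f \<Longrightarrow> f \<in> borel_measurable borel"
  by (intro borel_measurable_continuous_onI entire_imp_continuous)

lemma bounded_linear_vector_scalar_mult_left: "bounded_linear (\<lambda>c. c *s v)" for v :: "complex^'n"
proof (rule bounded_linear_intro[where K = "norm v"])
  show "(r *\<^sub>R a) *s v = r *\<^sub>R (a *s v)" for r a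
    by (simp add: vec_eq_iff)
qed (simp_all add: vector_sadd_rdistrib norm_vector_scalar_mult)

lemma entire_holomorphic_on_line:
  fixes f :: "complex^'n \<Rightarrow> complex"
  assumes "entire f"
  shows "(\<lambda>\<zeta>. f (z + \<zeta> *s v)) holomorphic_on UNIV"
proof -
  have "\<exists>D. ((\<lambda>\<zeta>. f (z + \<zeta> *s v)) has_field_derivative D) (at \<zeta>)" for \<zeta>
  proof -
    obtain f' where f': "(f has_derivative f') (at (z + \<zeta> *s v))" and lin: "\<And>c v. f' (c *s v) = c * f' v"
      using assms unfolding entire_def by blast
    have "((\<lambda>\<zeta>. z + \<zeta> *s v) has_derivative (\<lambda>h. h *s v)) (at \<zeta>)"
      by (auto intro!: derivative_eq_intros bounded_linear_imp_has_derivative bounded_linear_vector_scalar_mult_left)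
    then have "((\<lambda>\<zeta>. f (z + \<zeta> *s v)) has_derivative (\<lambda>h. f' (h *s v))) (at \<zeta>)"
      by (rule has_derivative_compose) (rule f')
    moreover have "(\<lambda>h. f' (h *s v)) = (*) (f' v)"
      by (simp add: fun_eq_iff lin mult.commute)
    ultimately show ?thesis
      unfolding has_field_derivative_def by metis
  qed
  then show ?thesis
    by (simp add: holomorphic_on_def field_differentiable_def)
qed

text \<open>
  Fock norms and Carleson integrals depend on \<open>f\<close> only through this function, and multiplying a
  translate of \<open>f\<close> by a suitable exponential of an affine function translates it.
\<close>

definition weighted_modulus :: "real \<Rightarrow> (complex^'n \<Rightarrow> complex) \<Rightarrow> complex^'n \<Rightarrow> real" where
  "weighted_modulus \<alpha> f z = norm (f z) * exp (- (\<alpha> / 2) * (norm z)\<^sup>2)"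

lemma weighted_modulus_nonneg [simp]: "0 \<le> weighted_modulus \<alpha> f z"
  by (simp add: weighted_modulus_def)

lemma weighted_modulus_powr:
  "norm (f z) powr s * exp (- (\<alpha> * s / 2) * (norm z)\<^sup>2) = weighted_modulus \<alpha> f z powr s"
  unfolding weighted_modulus_def by (subst powr_mult) (simp_all add: exp_powr_real mult_ac)

lemma measurable_weighted_modulus [measurable]:
  "f \<in> borel_measurable borel \<Longrightarrow> weighted_modulus \<alpha> f \<in> borel_measurable borel"
  unfolding weighted_modulus_def
  by (intro borel_measurable_times borel_measurable_continuous_onI[of "\<lambda>z. exp (- (\<alpha> / 2) * (norm z)\<^sup>2)"])
     (auto intro!: continuous_intros)

text \<open>
  The mean value inequality at an arbitrary centre \<open>z\<close>.  Applied directly to \<open>f\<close>, it would lose the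
  unbounded ratio of the Gaussian weights at \<open>z\<close> and near \<open>z\<close>.  The factor \<open>exp (- \<alpha> \<langle>v, z\<rangle>)\<close> in \<open>G\<close> is
  holomorphic in \<open>v\<close> and absorbs that ratio up to \<open>exp (\<alpha> |v|\<^sup>2 / 2)\<close>, which is bounded on the unit ball.
\<close>

lemma weighted_modulus_le_ball_mean:
  fixes f :: "complex^'n \<Rightarrow> complex"
  assumes \<alpha>: "0 < \<alpha>" and f: "entire f"
  shows "ennreal (weighted_modulus \<alpha> f z) * emeasure lborel (ball (0 :: complex^'n) 1)
    \<le> ennreal (exp (\<alpha> / 2)) * (\<integral>\<^sup>+u. indicator (ball z 1) u * ennreal (weighted_modulus \<alpha> f u) \<partial>lborel)"
proof -
  let ?B = "ball (0 :: complex^'n) 1"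
  define G where "G v = f (z + v) * exp (- of_real \<alpha> * hermitian v z)" for v
  have [measurable]: "f \<in> borel_measurable borel"
    by (rule entire_imp_measurable[OF f])
  have cont: "continuous_on UNIV G"
    unfolding G_def
    by (intro continuous_intros continuous_on_compose2[OF entire_imp_continuous[OF f]]) auto
  have [measurable]: "G \<in> borel_measurable borel"
    by (rule borel_measurable_continuous_onI[OF cont])
  have hol: "(\<lambda>\<zeta>. G (\<zeta> *s v)) holomorphic_on UNIV" for v
    unfolding G_def hermitian_scale_left
    by (intro holomorphic_intros entire_holomorphic_on_line[OF f])
  have norm_G: "exp (- (\<alpha> / 2) * (norm z)\<^sup>2) * norm (G v) = weighted_modulus \<alpha> f (v + z) * exp (\<alpha> / 2 * (norm v)\<^sup>2)" for v
  proof -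
    have "(norm (v + z))\<^sup>2 = (norm v)\<^sup>2 + 2 * (v \<bullet> z) + (norm z)\<^sup>2"
      by (simp add: power2_norm_eq_inner inner_add inner_commute)
    then have "- (\<alpha> / 2) * (norm z)\<^sup>2 - \<alpha> * (v \<bullet> z) = - (\<alpha> / 2) * (norm (v + z))\<^sup>2 + \<alpha> / 2 * (norm v)\<^sup>2"
      by (simp add: algebra_simps)
    then show ?thesis
      by (simp add: G_def weighted_modulus_def norm_mult Re_hermitian add.commute mult_ac flip: exp_add)
  qed
  have "ennreal (weighted_modulus \<alpha> f z) * emeasure lborel ?B
      = ennreal (exp (- (\<alpha> / 2) * (norm z)\<^sup>2)) * (ennreal (norm (G 0)) * emeasure lborel ?B)"
    by (simp add: G_def weighted_modulus_def ennreal_mult mult_ac)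
  also have "\<dots> \<le> ennreal (exp (- (\<alpha> / 2) * (norm z)\<^sup>2)) * (\<integral>\<^sup>+v. indicator ?B v * ennreal (norm (G v)) \<partial>lborel)"
    by (intro mult_left_mono norm_center_le_ball_mean[OF cont hol]) auto
  also have "\<dots> = (\<integral>\<^sup>+v. indicator ?B v * ennreal (exp (- (\<alpha> / 2) * (norm z)\<^sup>2) * norm (G v)) \<partial>lborel)"
    by (subst nn_integral_cmult[symmetric]) (auto simp: ennreal_mult mult_ac)
  also have "\<dots> \<le> (\<integral>\<^sup>+v. ennreal (exp (\<alpha> / 2)) * (indicator (ball z 1) (v + z) * ennreal (weighted_modulus \<alpha> f (v + z))) \<partial>lborel)"
  proof (rule nn_integral_mono)
    fix v :: "complex^'n"
    have "weighted_modulus \<alpha> f (v + z) * exp (\<alpha> / 2 * (norm v)\<^sup>2) \<le> exp (\<alpha> / 2) * weighted_modulus \<alpha> f (v + z)"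
      if "norm v < 1"
      using that \<alpha> by (subst mult.commute) (intro mult_right_mono, auto simp: power_le_one)
    then show "indicator ?B v * ennreal (exp (- (\<alpha> / 2) * (norm z)\<^sup>2) * norm (G v))
       \<le> ennreal (exp (\<alpha> / 2)) * (indicator (ball z 1) (v + z) * ennreal (weighted_modulus \<alpha> f (v + z)))"
      unfolding norm_G by (auto simp: indicator_def dist_norm ennreal_leI simp flip: ennreal_mult)
  qed
  also have "\<dots> = ennreal (exp (\<alpha> / 2)) * (\<integral>\<^sup>+v. indicator (ball z 1) (v + z) * ennreal (weighted_modulus \<alpha> f (v + z)) \<partial>lborel)"
    by (rule nn_integral_cmult) measurable
  also have "(\<integral>\<^sup>+v. indicator (ball z 1) (v + z) * ennreal (weighted_modulus \<alpha> f (v + z)) \<partial>lborel)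
      = (\<integral>\<^sup>+u. indicator (ball z 1) u * ennreal (weighted_modulus \<alpha> f u) \<partial>lborel)"
    by (rule nn_integral_lborel_shift) measurable
  finally show ?thesis .
qed

text \<open>
  This replaces Hoelder's inequality when a mean of \<open>x\<close> has to be bounded by a mean of \<open>x\<^sup>p\<close>; the
  free parameter \<open>s\<close> restores the homogeneity.
\<close>

lemma le_add_powr:
  fixes x s p :: real
  assumes "0 \<le> x" "0 < s" "1 \<le> p"
  shows "x \<le> s + s powr (1 - p) * x powr p"
proof (cases "x \<le> s")
  case False
  then have "1 \<le> x / s"
    using assms by simp
  then have "(x / s) powr 1 \<le> (x / s) powr p"
    using assms by (intro powr_mono)
  then have "x \<le> s * (x / s) powr p"
    using assms False by (simp add: field_simps)
  also have "\<dots> = s powr (1 - p) * x powr p"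
    using assms False by (simp add: powr_divide powr_diff)
  finally show ?thesis
    using assms by linarith
next
  case True
  then show ?thesis
    using assms by (simp add: add_increasing2)
qed

lemma fock_space_entire: "f \<in> fock_space \<alpha> p \<Longrightarrow> entire f"
  by (simp add: fock_space_def)

lemma fock_integral_eq:
  "fock_integral \<alpha> s (f :: complex^'n \<Rightarrow> complex) = ennreal ((\<alpha> * s / (2 * pi)) ^ CARD('n)) *
     (\<integral>\<^sup>+ z. ennreal (weighted_modulus \<alpha> f z powr s) \<partial>lborel)"
  unfolding fock_integral_def weighted_modulus_powr ..

lemma fock_norm_nonneg [simp]: "0 \<le> fock_norm \<alpha> (ennreal p) f"
  by (simp add: fock_norm_def)

lemma nn_integral_weighted_modulus:
  fixes f :: "complex^'n \<Rightarrow> complex"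
  assumes \<alpha>: "0 < \<alpha>" and p: "0 < p" and f: "f \<in> fock_space \<alpha> (ennreal p)"
  shows "(\<integral>\<^sup>+ z. ennreal (weighted_modulus \<alpha> f z powr p) \<partial>lborel)
    = ennreal (fock_norm \<alpha> (ennreal p) f powr p / (\<alpha> * p / (2 * pi)) ^ CARD('n))"
proof -
  define c where "c = (\<alpha> * p / (2 * pi)) ^ CARD('n)"
  define I where "I = (\<integral>\<^sup>+ z. ennreal (weighted_modulus \<alpha> f z powr p) \<partial>lborel)"
  have c: "0 < c"
    using \<alpha> p by (simp add: c_def)
  have fin: "ennreal c * I < \<infinity>" and norm: "fock_norm \<alpha> (ennreal p) f = enn2real (ennreal c * I) powr (1 / p)"
    using f p by (simp_all add: fock_space_def fock_norm_def fock_integral_eq c_def I_def)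
  then have I: "I = ennreal (enn2real I)"
    using c by (auto simp: ennreal_mult_less_top ennreal_enn2real_if)
  have "fock_norm \<alpha> (ennreal p) f powr p = c * enn2real I"
    using p c by (simp add: norm powr_powr enn2real_mult)
  then show ?thesis
    using I c by (simp add: I_def[symmetric] c_def[symmetric])
qed

text \<open>
  The bounded inclusion of every Fock space of exponent \<open>p \<ge> 1\<close> into the one of exponent \<open>\<infinity>\<close>: bound
  the value at \<open>z\<close> by the mean over the unit ball around \<open>z\<close>, and that mean by the integral of the
  \<open>p\<close>-th power over the whole space.
\<close>

lemma weighted_modulus_le_fock_norm:
  assumes \<alpha>: "0 < \<alpha>" and p: "1 \<le> p"
  shows "\<exists>C>0. \<forall>f \<in> fock_space \<alpha> (ennreal p). \<forall>z :: complex^'n. weighted_modulus \<alpha> f z \<le> C * fock_norm \<alpha> (ennreal p) f"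
proof -
  define V where "V = unit_ball_vol (real DIM(complex^'n))"
  have V: "0 < V" "emeasure lborel (ball (0 :: complex^'n) 1) = ennreal V"
    unfolding V_def by (rule unit_ball_vol_pos) (simp_all add: emeasure_ball)
  have V': "emeasure lborel (ball z 1) = ennreal V" for z :: "complex^'n"
    unfolding V_def by (simp add: emeasure_ball)
  define c where "c = (\<alpha> * p / (2 * pi)) ^ CARD('n)"
  have c: "0 < c"
    using \<alpha> p by (simp add: c_def)
  define C where "C = exp (\<alpha> / 2) * (1 + 1 / (c * V))"
  have C: "0 < C"
    using c V by (auto simp: C_def intro!: mult_pos_pos add_pos_pos)
  have "weighted_modulus \<alpha> f z \<le> C * fock_norm \<alpha> (ennreal p) f"
    if f: "f \<in> fock_space \<alpha> (ennreal p)" for f and z :: "complex^'n"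
  proof -
    define N where "N = fock_norm \<alpha> (ennreal p) f"
    have N: "0 \<le> N"
      by (simp add: N_def)
    have [measurable]: "f \<in> borel_measurable borel"
      by (rule entire_imp_measurable[OF fock_space_entire[OF f]])
    \<comment> \<open>The choice \<open>s = N\<close> would be natural; letting \<open>s\<close> tend to \<open>N\<close> from above avoids a separate
      treatment of \<open>N = 0\<close>.\<close>
    have "weighted_modulus \<alpha> f z / C \<le> s" if s: "N < s" for s
    proof -
      have s0: "0 < s"
        using s N by simp
      have "(\<integral>\<^sup>+u. indicator (ball z 1) u * ennreal (weighted_modulus \<alpha> f u) \<partial>lborel)
          \<le> (\<integral>\<^sup>+u. ennreal s * indicator (ball z 1) u + ennreal (s powr (1 - p)) * ennreal (weighted_modulus \<alpha> f u powr p) \<partial>lborel)"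
      proof (rule nn_integral_mono)
        fix u
        have "ennreal (weighted_modulus \<alpha> f u) \<le> ennreal s + ennreal (s powr (1 - p)) * ennreal (weighted_modulus \<alpha> f u powr p)"
          using le_add_powr[OF weighted_modulus_nonneg s0 p, of \<alpha> f u] s0
          by (simp add: ennreal_leI flip: ennreal_mult ennreal_plus)
        then show "indicator (ball z 1) u * ennreal (weighted_modulus \<alpha> f u)
            \<le> ennreal s * indicator (ball z 1) u + ennreal (s powr (1 - p)) * ennreal (weighted_modulus \<alpha> f u powr p)"
          by (cases "u \<in> ball z 1") simp_all
      qed
      also have "\<dots> = ennreal s * ennreal V + ennreal (s powr (1 - p)) * ennreal (N powr p / c)"
        using p unfolding N_def c_def
        by (subst nn_integral_add) (auto simp: nn_integral_cmult nn_integral_cmult_indicator V' nn_integral_weighted_modulus[OF \<alpha> _ f])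
      also have "\<dots> \<le> ennreal (s * V + s / c)"
      proof -
        have "s powr (1 - p) * N powr p \<le> s powr (1 - p) * s powr p"
          using s N p by (intro mult_left_mono powr_mono2) auto
        also have "\<dots> = s"
          using s0 by (simp flip: powr_add)
        finally have "s powr (1 - p) * (N powr p / c) \<le> s / c"
          using c by (simp add: divide_right_mono)
        then show ?thesis
          using s0 V c N by (simp add: ennreal_leI flip: ennreal_mult ennreal_plus)
      qed
      finally have "ennreal (weighted_modulus \<alpha> f z) * ennreal V \<le> ennreal (exp (\<alpha> / 2)) * ennreal (s * V + s / c)"
        using weighted_modulus_le_ball_mean[OF \<alpha> fock_space_entire[OF f], of z] unfolding V'
        by (meson mult_left_mono order_trans zero_le)
      then have "weighted_modulus \<alpha> f z * V \<le> exp (\<alpha> / 2) * (s * V + s / c)"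
        using V s0 c by (simp add: ennreal_mult[symmetric] del: ennreal_plus)
      also have "\<dots> = C * s * V"
        using V c by (simp add: C_def field_simps)
      finally show ?thesis
        using V C by (simp add: field_simps)
    qed
    then have "weighted_modulus \<alpha> f z / C \<le> N"
      by (rule dense_ge)
    then show ?thesis
      using C by (simp add: N_def field_simps)
  qed
  then show ?thesis
    using C by blast
qed

section \<open>Gaussian integrals and normalized kernels\<close>

lemma nn_integral_gaussian_real:
  assumes c: "0 < (c::real)"
  shows "(\<integral>\<^sup>+ x. ennreal (exp (- c * x\<^sup>2)) \<partial>lborel) = ennreal (sqrt (pi / c))"
proof -
  define \<sigma> where "\<sigma> = 1 / sqrt (2 * c)"
  have \<sigma>: "0 < \<sigma>" "\<sigma>\<^sup>2 = 1 / (2 * c)"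
    using c by (simp_all add: \<sigma>_def power_divide)
  have dens: "exp (- c * x\<^sup>2) = sqrt (pi / c) * normal_density 0 \<sigma> x" for x
    using c by (simp add: normal_density_def \<sigma> real_sqrt_divide)
  have "(\<integral>\<^sup>+ x. ennreal (normal_density 0 \<sigma> x) \<partial>lborel) = 1"
    using \<sigma> by (subst nn_integral_eq_integral) auto
  then show ?thesis
    unfolding dens using c by (simp add: ennreal_mult nn_integral_cmult)
qed

lemma nn_integral_gaussian:
  fixes w :: "'a::euclidean_space"
  assumes c: "0 < (c::real)"
  shows "(\<integral>\<^sup>+ z. ennreal (exp (- c * (norm (z - w))\<^sup>2)) \<partial>lborel) = ennreal (sqrt (pi / c) ^ DIM('a))"
proof -
  have "(\<integral>\<^sup>+ z. ennreal (exp (- c * (norm (z - w))\<^sup>2)) \<partial>lborel)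
      = (\<integral>\<^sup>+ z. ennreal (exp (- c * (norm (z :: 'a))\<^sup>2)) \<partial>lborel)"
    using nn_integral_lborel_shift[of "\<lambda>z. ennreal (exp (- c * (norm z)\<^sup>2))" "- w"] by simp
  also have "\<dots> = (\<integral>\<^sup>+ z. (\<Prod>b\<in>Basis. ennreal (exp (- c * (z \<bullet> b)\<^sup>2))) \<partial>(lborel :: 'a measure))"
  proof (rule nn_integral_cong)
    fix z :: 'a
    have "- c * (norm z)\<^sup>2 = (\<Sum>b\<in>Basis. - c * (z \<bullet> b)\<^sup>2)"
      by (simp only: sum_distrib_left[symmetric]) (subst power2_norm_eq_inner, subst euclidean_inner, simp add: power2_eq_square)
    then show "ennreal (exp (- c * (norm z)\<^sup>2)) = (\<Prod>b\<in>Basis. ennreal (exp (- c * (z \<bullet> b)\<^sup>2)))"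
      by (simp add: exp_sum prod_ennreal)
  qed
  also have "\<dots> = (\<Prod>b\<in>(Basis :: 'a set). (\<integral>\<^sup>+ x. ennreal (exp (- c * x\<^sup>2)) \<partial>lborel))"
    by (rule nn_integral_lborel_prod) auto
  also have "\<dots> = ennreal (sqrt (pi / c) ^ DIM('a))"
    unfolding nn_integral_gaussian_real[OF c] prod_constant
    by (rule ennreal_power) (use c in simp)
  finally show ?thesis .
qed

lemma DIM_complex_vec: "DIM(complex^'n) = 2 * CARD('n)"
  by simp

text \<open>
  Completing the square: the weighted kernel is a translate of one fixed Gaussian, which explains
  both its norm and the shape of the Berezin transform.
\<close>

lemma weighted_modulus_kernel:
  "weighted_modulus \<alpha> (normalized_fock_kernel \<alpha> w) z = exp (- (\<alpha> / 2) * (norm (z - w))\<^sup>2)"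
proof -
  have "(norm (z - w))\<^sup>2 = (norm z)\<^sup>2 - 2 * (z \<bullet> w) + (norm w)\<^sup>2"
    by (simp add: power2_norm_eq_inner inner_diff inner_commute)
  then have "\<alpha> * (z \<bullet> w) - \<alpha> * (norm w)\<^sup>2 / 2 + - (\<alpha> / 2) * (norm z)\<^sup>2 = - (\<alpha> / 2) * (norm (z - w))\<^sup>2"
    by (simp only: \<open>(norm (z - w))\<^sup>2 = _\<close>) (simp add: algebra_simps)
  then show ?thesis
    by (simp add: weighted_modulus_def normalized_fock_kernel_def Re_hermitian flip: exp_add)
qed

lemma entire_normalized_fock_kernel: "entire (normalized_fock_kernel \<alpha> (w :: complex^'n))"
  unfolding entire_def
proof (intro allI exI conjI)
  fix z :: "complex^'n"
  let ?D = "\<lambda>h. normalized_fock_kernel \<alpha> w z * (of_real \<alpha> * hermitian h w)"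
  have "((\<lambda>z. hermitian z w) has_derivative (\<lambda>h. hermitian h w)) (at z)"
    by (rule bounded_linear_imp_has_derivative[OF bounded_linear_hermitian])
  then have "((\<lambda>z. of_real \<alpha> * hermitian z w - of_real (\<alpha> * (norm w)\<^sup>2 / 2)) has_derivative
      (\<lambda>h. of_real \<alpha> * hermitian h w - 0)) (at z)"
    by (intro has_derivative_diff has_derivative_mult_right has_derivative_const)
  from has_derivative_compose[OF this DERIV_exp[unfolded has_field_derivative_def]]
  show "(normalized_fock_kernel \<alpha> w has_derivative ?D) (at z)"
    unfolding normalized_fock_kernel_def[abs_def] by simp
  show "?D (c *s v) = c * ?D v" for c v
    by (simp add: hermitian_scale_left)
qed

text \<open>
  The constant \<open>(\<alpha> p / (2 \<pi>))\<^sup>n\<close> in the definition of the norm is exactly the reciprocal of the Gaussian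
  integral, so the kernels are unit vectors for every exponent and can serve as test functions
  without further normalization.
\<close>

lemma normalized_fock_kernel_norm:
  fixes w :: "complex^'n"
  assumes \<alpha>: "0 < \<alpha>" and p: "0 < p"
  shows "normalized_fock_kernel \<alpha> w \<in> fock_space \<alpha> (ennreal p)"
    and "fock_norm \<alpha> (ennreal p) (normalized_fock_kernel \<alpha> w) = 1"
proof -
  let ?k = "normalized_fock_kernel \<alpha> w"
  have "(\<integral>\<^sup>+ z. ennreal (weighted_modulus \<alpha> ?k z powr p) \<partial>lborel)
      = (\<integral>\<^sup>+ z. ennreal (exp (- (\<alpha> * p / 2) * (norm (z - w))\<^sup>2)) \<partial>lborel)"
  proof (rule nn_integral_cong)
    fix z :: "complex^'n"
    show "ennreal (weighted_modulus \<alpha> ?k z powr p) = ennreal (exp (- (\<alpha> * p / 2) * (norm (z - w))\<^sup>2))"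
      unfolding weighted_modulus_kernel by (simp add: powr_def algebra_simps)
  qed
  also have "\<dots> = ennreal (sqrt (pi / (\<alpha> * p / 2)) ^ (2 * CARD('n)))"
    using nn_integral_gaussian[of "\<alpha> * p / 2" w] \<alpha> p unfolding DIM_complex_vec by simp
  also have "sqrt (pi / (\<alpha> * p / 2)) ^ (2 * CARD('n)) = (2 * pi / (\<alpha> * p)) ^ CARD('n)"
    using \<alpha> p unfolding power_mult by (simp add: mult.commute)
  finally have int: "(\<integral>\<^sup>+ z. ennreal (weighted_modulus \<alpha> ?k z powr p) \<partial>lborel)
      = ennreal ((2 * pi / (\<alpha> * p)) ^ CARD('n))" .
  have "(\<alpha> * p / (2 * pi)) ^ CARD('n) * (2 * pi / (\<alpha> * p)) ^ CARD('n) = 1"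
    unfolding power_mult_distrib[symmetric] using \<alpha> p by simp
  then have "fock_integral \<alpha> p ?k = 1"
    using \<alpha> p unfolding fock_integral_eq int by (subst ennreal_mult[symmetric]) simp_all
  then show "?k \<in> fock_space \<alpha> (ennreal p)" "fock_norm \<alpha> (ennreal p) ?k = 1"
    using p by (simp_all add: fock_space_def fock_norm_def entire_normalized_fock_kernel)
qed

section \<open>Masses of balls and Gaussian averages\<close>

lemma AE_lborel_in_ball:
  fixes y :: "'a::euclidean_space"
  assumes "AE u in lborel. P u" "0 < r"
  shows "\<exists>u\<in>ball y r. P u"
proof (rule ccontr)
  assume "\<not> ?thesis"
  then have "AE u in lborel. u \<notin> ball y r"
    using assms(1) by (auto elim: eventually_mono)
  then have "emeasure lborel (ball y r) = 0"
    by (subst (asm) AE_iff_null_sets[symmetric]) auto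
  moreover have "unit_ball_vol (real DIM('a)) * r ^ DIM('a) > 0"
    using assms(2) by (intro mult_pos_pos unit_ball_vol_pos) auto
  ultimately show False
    using assms(2) by (simp add: emeasure_ball)
qed

text \<open>
  Radii can be changed, and the essential supremum can be used in place of the supremum, at the
  cost of a constant: the number of balls of radius \<open>\<delta> / 2\<close> needed to cover a ball of radius \<open>\<epsilon>\<close>,
  which by translation does not depend on the centre.
\<close>

lemma emeasure_ball_le_Linf_norm:
  assumes "0 < \<delta>"
  shows "\<exists>C>0. \<forall>\<mu> :: (complex^'n) measure. sets \<mu> = sets borel \<longrightarrow>
    (\<forall>z. emeasure \<mu> (ball z \<epsilon>) \<le> ennreal C * Linf_norm (\<lambda>u. emeasure \<mu> (ball u \<delta>)))"
proof -
  have "compact (cball (0 :: complex^'n) \<epsilon>)"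
    by simp
  then obtain F where F: "finite F" "cball (0 :: complex^'n) \<epsilon> \<subseteq> (\<Union>x\<in>F. ball x (\<delta> / 2))"
    unfolding compact_eq_totally_bounded using assms by (meson half_gt_zero)
  \<comment> \<open>The successor makes the constant positive when \<open>F\<close> is empty.\<close>
  show ?thesis
  proof (intro exI[of _ "real (Suc (card F))"] conjI allI impI)
    fix \<mu> :: "(complex^'n) measure" and z :: "complex^'n"
    assume sets[simp]: "sets \<mu> = sets borel"
    define M where "M = Linf_norm (\<lambda>u. emeasure \<mu> (ball u \<delta>))"
    \<comment> \<open>Almost every \<open>u\<close> satisfies the bound \<open>M\<close>, hence some \<open>u\<close> close to \<open>y\<close> does, and the ball
      around that \<open>u\<close> contains the half-sized ball around \<open>y\<close>.\<close>
    have small: "emeasure \<mu> (ball y (\<delta> / 2)) \<le> M" for y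
    proof -
      have "AE u in lborel. emeasure \<mu> (ball u \<delta>) \<le> M"
        unfolding M_def Linf_norm_def by (rule esssup_AE)
      from AE_lborel_in_ball[OF this, of "\<delta> / 2" y] assms
      obtain u where u: "u \<in> ball y (\<delta> / 2)" "emeasure \<mu> (ball u \<delta>) \<le> M"
        by auto
      have "ball y (\<delta> / 2) \<subseteq> ball u \<delta>"
      proof
        fix x assume "x \<in> ball y (\<delta> / 2)"
        then show "x \<in> ball u \<delta>"
          using u(1) dist_triangle3[of u x y] by simp
      qed
      then have "emeasure \<mu> (ball y (\<delta> / 2)) \<le> emeasure \<mu> (ball u \<delta>)"
        by (rule emeasure_mono) simp
      then show ?thesis
        using u(2) by (rule order_trans)
    qed
    have "ball z \<epsilon> \<subseteq> (\<Union>x\<in>F. ball (z + x) (\<delta> / 2))"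
    proof
      fix y assume "y \<in> ball z \<epsilon>"
      then have "y - z \<in> cball 0 \<epsilon>"
        by (simp add: dist_norm norm_minus_commute)
      then obtain x where "x \<in> F" "dist x (y - z) < \<delta> / 2"
        using F by auto
      then show "y \<in> (\<Union>x\<in>F. ball (z + x) (\<delta> / 2))"
        by (auto simp: dist_norm algebra_simps intro!: bexI[of _ x])
    qed
    then have "emeasure \<mu> (ball z \<epsilon>) \<le> emeasure \<mu> (\<Union>x\<in>F. ball (z + x) (\<delta> / 2))"
      using F by (intro emeasure_mono) auto
    also have "\<dots> \<le> (\<Sum>x\<in>F. emeasure \<mu> (ball (z + x) (\<delta> / 2)))"
      using F by (intro emeasure_subadditive_finite) auto
    also have "\<dots> \<le> of_nat (card F) * M"
      by (rule sum_bounded_above) (rule small)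
    also have "\<dots> \<le> ennreal (real (Suc (card F))) * M"
      unfolding ennreal_of_nat_eq_real_of_nat by (intro mult_right_mono ennreal_leI) auto
    finally show "emeasure \<mu> (ball z \<epsilon>) \<le> ennreal (real (Suc (card F))) * Linf_norm (\<lambda>u. emeasure \<mu> (ball u \<delta>))"
      by (simp add: M_def)
  qed simp
qed

lemma measurable_pair_of_borel:
  fixes M :: "'a::second_countable_topology measure" and N :: "'b::second_countable_topology measure"
  assumes M: "sets M = sets borel" and N: "sets N = sets borel" and f: "f \<in> borel_measurable borel"
  shows "f \<in> borel_measurable (M \<Otimes>\<^sub>M N)"
proof -
  have "sets (M \<Otimes>\<^sub>M N) = sets (borel :: ('a \<times> 'b) measure)"
    unfolding borel_prod[symmetric] by (rule sets_pair_measure_cong[OF M N])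
  then show ?thesis
    using f by (simp cong: measurable_cong_sets)
qed

lemma sets_dist_less: "{(z, w). dist z w < \<delta>} \<in> sets (borel :: ('a::{metric_space, second_countable_topology} \<times> 'a) measure)"
proof -
  have "open {x :: 'a \<times> 'a. dist (fst x) (snd x) < \<delta>}"
    by (intro open_Collect_less continuous_intros)
  then show ?thesis
    by (intro borel_open) (simp add: case_prod_unfold)
qed

lemma measurable_emeasure_ball:
  fixes \<mu> :: "'a::euclidean_space measure"
  assumes sets: "sets \<mu> = sets borel" and fin: "sigma_finite_measure \<mu>"
  shows "(\<lambda>z. emeasure \<mu> (ball z \<delta>)) \<in> borel_measurable borel"
proof -
  have "(\<lambda>z. \<integral>\<^sup>+w. indicator {(z, w). dist z w < \<delta>} (z, w) \<partial>\<mu>) \<in> borel_measurable borel"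
    using sets by (intro sigma_finite_measure.borel_measurable_nn_integral[OF fin])
      (auto intro!: measurable_pair_of_borel borel_measurable_indicator sets_dist_less)
  moreover have "(\<integral>\<^sup>+w. indicator {(z, w). dist z w < \<delta>} (z, w) \<partial>\<mu>) = emeasure \<mu> (ball z \<delta>)" for z
  proof -
    have "(\<integral>\<^sup>+w. indicator {(z, w). dist z w < \<delta>} (z, w) \<partial>\<mu>) = (\<integral>\<^sup>+w. indicator (ball z \<delta>) w \<partial>\<mu>)"
      by (intro nn_integral_cong) (auto simp: indicator_def)
    then show ?thesis
      using sets by simp
  qed
  ultimately show ?thesis
    by simp
qed

lemma measurable_gaussian_average:
  fixes \<mu> :: "'a::euclidean_space measure"
  assumes sets: "sets \<mu> = sets borel" and fin: "sigma_finite_measure \<mu>"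
  shows "(\<lambda>w. \<integral>\<^sup>+z. ennreal (exp (- c * (norm (z - w))\<^sup>2)) \<partial>\<mu>) \<in> borel_measurable borel"
proof -
  have "(\<lambda>p :: 'a \<times> 'a. exp (- c * (norm (snd p - fst p))\<^sup>2)) \<in> borel_measurable borel"
    by (intro borel_measurable_continuous_onI continuous_intros)
  then have "(\<lambda>(w, z). ennreal (exp (- c * (norm (z - w))\<^sup>2))) \<in> borel_measurable (borel \<Otimes>\<^sub>M \<mu>)"
    using sets by (intro measurable_pair_of_borel) (auto simp: case_prod_beta)
  then show ?thesis
    by (rule sigma_finite_measure.borel_measurable_nn_integral[OF fin])
qed

text \<open>
  The common core of the Berezin and Carleson estimates.  Integrating the mean value inequality
  with respect to \<open>\<mu>\<close> and exchanging the integrals replaces \<open>\<mu>\<close> by the density \<open>u \<mapsto> \<mu>(D(u, 1))\<close>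
  with respect to Lebesgue measure.
\<close>

lemma nn_integral_le_of_ball_mean:
  fixes \<mu> :: "'a::euclidean_space measure" and g h :: "'a \<Rightarrow> ennreal"
  assumes sets: "sets \<mu> = sets borel" and fin: "sigma_finite_measure \<mu>"
    and B: "\<And>u. emeasure \<mu> (ball u 1) \<le> B"
    and h: "h \<in> borel_measurable borel" and g: "g \<in> borel_measurable borel"
    and mean: "\<And>z. h z * V \<le> K * (\<integral>\<^sup>+u. indicator (ball z 1) u * g u \<partial>lborel)"
  shows "(\<integral>\<^sup>+z. h z \<partial>\<mu>) * V \<le> K * B * (\<integral>\<^sup>+u. g u \<partial>lborel)"
proof -
  let ?D = "{(z, u). dist z u < 1} :: ('a \<times> 'a) set"
  let ?k = "\<lambda>z u. K * (indicator ?D (z, u) * g u)"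
  have meas: "case_prod ?k \<in> borel_measurable (\<mu> \<Otimes>\<^sub>M lborel)"
  proof (rule measurable_pair_of_borel[OF sets sets_lborel])
    have "(\<lambda>p :: 'a \<times> 'a. g (snd p)) \<in> borel_measurable borel"
      by (intro measurable_compose[OF _ g] borel_measurable_continuous_onI continuous_intros)
    then have "(\<lambda>p. K * (indicator ?D p * g (snd p))) \<in> borel_measurable borel"
      using sets_dist_less[of 1, where 'a='a] by measurable
    then show "case_prod ?k \<in> borel_measurable borel"
      by (simp add: case_prod_beta')
  qed
  interpret pair_sigma_finite \<mu> lborel
    using fin by (simp add: pair_sigma_finite_def sigma_finite_lborel)
  have "(\<integral>\<^sup>+z. h z \<partial>\<mu>) * V = (\<integral>\<^sup>+z. h z * V \<partial>\<mu>)"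
    using sets h by (intro nn_integral_multc[symmetric]) (simp cong: measurable_cong_sets)
  also have "\<dots> \<le> (\<integral>\<^sup>+z. (\<integral>\<^sup>+u. ?k z u \<partial>lborel) \<partial>\<mu>)"
  proof (rule nn_integral_mono)
    fix z
    have "K * (\<integral>\<^sup>+u. indicator (ball z 1) u * g u \<partial>lborel) = (\<integral>\<^sup>+u. ?k z u \<partial>lborel)"
      using g by (subst nn_integral_cmult[symmetric]) (auto intro!: nn_integral_cong simp: indicator_def)
    then show "h z * V \<le> (\<integral>\<^sup>+u. ?k z u \<partial>lborel)"
      using mean[of z] by simp
  qed
  also have "\<dots> = (\<integral>\<^sup>+u. (\<integral>\<^sup>+z. ?k z u \<partial>\<mu>) \<partial>lborel)"
    by (rule Fubini'[OF meas, symmetric])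
  also have "\<dots> = (\<integral>\<^sup>+u. emeasure \<mu> (ball u 1) * (K * g u) \<partial>lborel)"
  proof (rule nn_integral_cong)
    fix u
    have "(\<integral>\<^sup>+z. ?k z u \<partial>\<mu>) = (\<integral>\<^sup>+z. indicator (ball u 1) z * (K * g u) \<partial>\<mu>)"
      by (intro nn_integral_cong) (auto simp: indicator_def dist_commute)
    also have "\<dots> = emeasure \<mu> (ball u 1) * (K * g u)"
      using sets by (subst nn_integral_multc) auto
    finally show "(\<integral>\<^sup>+z. ?k z u \<partial>\<mu>) = emeasure \<mu> (ball u 1) * (K * g u)" .
  qed
  also have "\<dots> \<le> (\<integral>\<^sup>+u. K * B * g u \<partial>lborel)"
    using B by (intro nn_integral_mono) (simp add: mult.assoc mult.left_commute[of K] mult_right_mono)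
  also have "\<dots> = K * B * (\<integral>\<^sup>+u. g u \<partial>lborel)"
    using g by (intro nn_integral_cmult) simp
  finally show ?thesis .
qed

text \<open>
  A Gaussian is dominated, up to a constant, by the means over unit balls of the Gaussian with half
  the exponent, because \<open>|u - w|\<^sup>2 \<le> 2 |z - w|\<^sup>2 + 2\<close> for \<open>|z - u| < 1\<close>.  This is the
  mean value inequality to which the previous lemma is applied.
\<close>

lemma gaussian_average_le:
  fixes \<mu> :: "'a::euclidean_space measure"
  assumes c: "0 < c" and sets: "sets \<mu> = sets borel" and fin: "sigma_finite_measure \<mu>"
    and B: "\<And>u. emeasure \<mu> (ball u 1) \<le> B"
  shows "(\<integral>\<^sup>+z. ennreal (exp (- c * (norm (z - w))\<^sup>2)) \<partial>\<mu>)
    \<le> ennreal (exp c * sqrt (2 * pi / c) ^ DIM('a) / unit_ball_vol DIM('a)) * B"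
proof -
  define V where "V = unit_ball_vol (real DIM('a))"
  have V: "0 < V" and Vball: "emeasure lborel (ball z 1) = ennreal V" for z :: 'a
    unfolding V_def by (rule unit_ball_vol_pos) (simp_all add: emeasure_ball)
  define h where "h z = ennreal (exp (- c * (norm (z - w))\<^sup>2))" for z :: 'a
  define g where "g u = ennreal (exp (- (c / 2) * (norm (u - w))\<^sup>2))" for u :: 'a
  define G where "G = sqrt (2 * pi / c) ^ DIM('a)"
  have G: "(\<integral>\<^sup>+u. g u \<partial>lborel) = ennreal G" and G0: "0 \<le> G"
    using nn_integral_gaussian[of "c / 2" w] c by (simp_all add: g_def G_def mult.commute)
  have near: "h z \<le> ennreal (exp c) * g u" if "dist z u < 1" for z u
  proof -
    have "norm (u - w) \<le> norm (z - w) + 1"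
      using that norm_triangle_ineq[of "u - z" "z - w"] by (simp add: dist_norm norm_minus_commute)
    then have "(norm (u - w))\<^sup>2 \<le> (norm (z - w) + 1)\<^sup>2"
      by (rule power_mono) simp
    also have "\<dots> \<le> 2 * (norm (z - w))\<^sup>2 + 2"
      using sum_squares_ge_zero[of "norm (z - w) - 1" 0] by (simp add: power2_eq_square algebra_simps)
    finally have "c / 2 * (norm (u - w))\<^sup>2 \<le> c / 2 * (2 * (norm (z - w))\<^sup>2 + 2)"
      using c by (intro mult_left_mono) auto
    then have "- c * (norm (z - w))\<^sup>2 \<le> c + - (c / 2) * (norm (u - w))\<^sup>2"
      by (simp add: algebra_simps)
    then show ?thesis
      unfolding h_def g_def by (simp add: ennreal_leI flip: ennreal_mult exp_add)
  qed
  have meas: "h \<in> borel_measurable borel" "g \<in> borel_measurable borel"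
    unfolding h_def g_def
    by (intro measurable_compose[OF _ measurable_ennreal] borel_measurable_continuous_onI continuous_intros)+
  have mean: "h z * ennreal V \<le> ennreal (exp c) * (\<integral>\<^sup>+u. indicator (ball z 1) u * g u \<partial>lborel)" for z
  proof -
    have "h z * ennreal V = (\<integral>\<^sup>+u. h z * indicator (ball z 1) u \<partial>lborel)"
      by (simp add: nn_integral_cmult_indicator Vball)
    also have "\<dots> \<le> (\<integral>\<^sup>+u. ennreal (exp c) * (indicator (ball z 1) u * g u) \<partial>lborel)"
      using near by (intro nn_integral_mono) (simp add: indicator_def)
    also have "\<dots> = ennreal (exp c) * (\<integral>\<^sup>+u. indicator (ball z 1) u * g u \<partial>lborel)"
      using meas by (intro nn_integral_cmult) auto
    finally show ?thesis .
  qed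
  have "(\<integral>\<^sup>+z. h z \<partial>\<mu>) * ennreal V \<le> ennreal (exp c) * B * ennreal G"
    using nn_integral_le_of_ball_mean[OF sets fin B meas mean] by (simp add: G)
  then have "(\<integral>\<^sup>+z. h z \<partial>\<mu>) * ennreal V * ennreal (1 / V) \<le> ennreal (exp c) * B * ennreal G * ennreal (1 / V)"
    by (rule mult_right_mono) simp
  moreover have "(\<integral>\<^sup>+z. h z \<partial>\<mu>) * ennreal V * ennreal (1 / V) = (\<integral>\<^sup>+z. h z \<partial>\<mu>)"
    using V by (simp add: mult.assoc flip: ennreal_mult)
  moreover have "ennreal (exp c) * B * ennreal G * ennreal (1 / V) = ennreal (exp c * G / V) * B"
    using V G0 by (simp add: divide_inverse ennreal_mult mult_ac)
  ultimately show ?thesis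
    by (simp add: G_def V_def h_def)
qed

lemma berezin_eq: "berezin \<alpha> t \<mu> w = (\<integral>\<^sup>+z. ennreal (exp (- (t * \<alpha> / 2) * (norm (z - w))\<^sup>2)) \<partial>\<mu>)"
proof -
  have "norm (normalized_fock_kernel \<alpha> w z) powr t * exp (- (t * \<alpha> / 2) * (norm z)\<^sup>2)
      = exp (- (t * \<alpha> / 2) * (norm (z - w))\<^sup>2)" for z
    using weighted_modulus_powr[of "normalized_fock_kernel \<alpha> w" z t \<alpha>]
    by (simp add: weighted_modulus_kernel exp_powr_real mult_ac)
  then show ?thesis
    unfolding berezin_def by simp
qed

lemma emeasure_ball_le_berezin:
  assumes "0 < \<alpha>" "0 < t" and sets: "sets \<mu> = sets borel"
  shows "emeasure \<mu> (ball w \<delta>) \<le> ennreal (exp (t * \<alpha> / 2 * \<delta>\<^sup>2)) * berezin \<alpha> t \<mu> w"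
proof -
  have "emeasure \<mu> (ball w \<delta>) = (\<integral>\<^sup>+z. indicator (ball w \<delta>) z \<partial>\<mu>)"
    using sets by simp
  also have "\<dots> \<le> (\<integral>\<^sup>+z. ennreal (exp (t * \<alpha> / 2 * \<delta>\<^sup>2)) * ennreal (exp (- (t * \<alpha> / 2) * (norm (z - w))\<^sup>2)) \<partial>\<mu>)"
  proof (rule nn_integral_mono)
    fix z
    have "1 \<le> exp (t * \<alpha> / 2 * \<delta>\<^sup>2) * exp (- (t * \<alpha> / 2) * (norm (z - w))\<^sup>2)" if "z \<in> ball w \<delta>"
    proof -
      have "(norm (z - w))\<^sup>2 \<le> \<delta>\<^sup>2"
        using that by (intro power_mono) (auto simp: dist_norm norm_minus_commute)
      then have "t * \<alpha> / 2 * (norm (z - w))\<^sup>2 \<le> t * \<alpha> / 2 * \<delta>\<^sup>2"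
        using assms by (intro mult_left_mono) auto
      then show ?thesis
        by (simp flip: exp_add)
    qed
    then show "indicator (ball w \<delta>) z
        \<le> ennreal (exp (t * \<alpha> / 2 * \<delta>\<^sup>2)) * ennreal (exp (- (t * \<alpha> / 2) * (norm (z - w))\<^sup>2))"
      by (auto simp: indicator_def simp flip: ennreal_mult ennreal_1 intro!: ennreal_leI)
  qed
  also have "\<dots> = ennreal (exp (t * \<alpha> / 2 * \<delta>\<^sup>2)) * berezin \<alpha> t \<mu> w"
    unfolding berezin_eq using sets
    by (intro nn_integral_cmult) (auto intro!: borel_measurable_continuous_onI continuous_intros cong: measurable_cong_sets)
  finally show ?thesis .
qed

text \<open>
  Admissibility at \<open>z = 0\<close> says that \<open>\<mu>\<close> integrates a positive Gaussian, so balls have finite mass.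
\<close>

lemma admissible_imp_sigma_finite:
  assumes adm: "admissible \<alpha> \<mu>" and \<alpha>: "0 < \<alpha>" and sets: "sets \<mu> = sets borel"
  shows "sigma_finite_measure \<mu>"
proof -
  have "berezin \<alpha> 2 \<mu> 0 < \<infinity>"
    using adm[unfolded admissible_def, rule_format, of 0] by (simp add: berezin_eq fock_kernel_def)
  then have "emeasure \<mu> (ball 0 (real n)) < \<infinity>" for n
    using emeasure_ball_le_berezin[OF \<alpha> _ sets, of 2 0 "real n"]
    by (auto simp: ennreal_mult_less_top intro: le_less_trans)
  moreover have "(\<Union>n. ball 0 (real n)) = space \<mu>"
    using sets_eq_imp_space_eq[OF sets] by (auto simp: reals_Archimedean2)
  ultimately show ?thesis
    using sets by (intro sigma_finite_measure.intro exI[of _ "range (\<lambda>n. ball 0 (real n))"]) (auto simp: less_top)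
qed

section \<open>The Toeplitz operator\<close>

lemma norm_toeplitz_integrand:
  "norm (toeplitz_integrand \<alpha> f z w)
    = exp (\<alpha> / 2 * (norm z)\<^sup>2) * (exp (- (\<alpha> / 2) * (norm (w - z))\<^sup>2) * weighted_modulus \<alpha> f w)"
proof -
  have sq: "(norm (w - z))\<^sup>2 = (norm z)\<^sup>2 - 2 * (z \<bullet> w) + (norm w)\<^sup>2"
    by (simp add: power2_norm_eq_inner inner_diff inner_commute)
  have "\<alpha> / 2 * (norm z)\<^sup>2 + - (\<alpha> / 2) * (norm (w - z))\<^sup>2 + - (\<alpha> / 2) * (norm w)\<^sup>2
      = \<alpha> * (z \<bullet> w) + - \<alpha> * (norm w)\<^sup>2"
    unfolding sq by (simp add: algebra_simps)
  then have "exp (\<alpha> / 2 * (norm z)\<^sup>2) * exp (- (\<alpha> / 2) * (norm (w - z))\<^sup>2) * exp (- (\<alpha> / 2) * (norm w)\<^sup>2)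
      = exp (\<alpha> * (z \<bullet> w)) * exp (- \<alpha> * (norm w)\<^sup>2)"
    by (metis exp_add)
  then show ?thesis
    by (simp add: toeplitz_integrand_def fock_kernel_def weighted_modulus_def norm_mult Re_hermitian mult_ac)
qed

lemma measurable_toeplitz_integrand:
  assumes "f \<in> borel_measurable borel"
  shows "toeplitz_integrand \<alpha> f z \<in> borel_measurable borel"
proof -
  have "(\<lambda>w. fock_kernel \<alpha> w z * of_real (exp (- \<alpha> * (norm w)\<^sup>2))) \<in> borel_measurable borel"
    unfolding fock_kernel_def by (intro borel_measurable_continuous_onI continuous_intros)
  then have "(\<lambda>w. fock_kernel \<alpha> w z * of_real (exp (- \<alpha> * (norm w)\<^sup>2)) * f w) \<in> borel_measurable borel"
    using assms by (rule borel_measurable_times)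
  then show ?thesis
    unfolding toeplitz_integrand_def[abs_def] by (simp only: mult_ac)
qed

text \<open>
  The exponential factor leaves room for differentiation under the integral sign: derivatives of
  the kernel with respect to \<open>z\<close> cost powers of \<open>|w|\<close>, and increments of \<open>z\<close> cost \<open>exp (\<alpha> |w|)\<close>.
  Half of the Gaussian decay \<open>exp (- \<alpha> |w|\<^sup>2 / 2)\<close> absorbs any such factor.
\<close>

lemma integrable_toeplitz_integrand_exp:
  fixes \<mu> :: "(complex^'n) measure"
  assumes \<alpha>: "0 < \<alpha>" and sets: "sets \<mu> = sets borel"
    and fin: "(\<integral>\<^sup>+w. ennreal (exp (- (\<alpha> / 4) * (norm w)\<^sup>2)) \<partial>\<mu>) < \<infinity>"
    and f: "f \<in> borel_measurable borel" and A: "\<And>w. weighted_modulus \<alpha> f w \<le> A"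
  shows "integrable \<mu> (\<lambda>w. norm (toeplitz_integrand \<alpha> f z w) * exp (b * norm w))"
proof (rule Bochner_Integration.integrable_bound)
  define m where "m = \<alpha> * norm z + b"
  have [measurable_cong]: "sets \<mu> = sets borel"
    by (rule sets)
  have "integrable \<mu> (\<lambda>w. exp (- (\<alpha> / 4) * (norm w)\<^sup>2))"
    using fin sets by (intro integrableI_bounded) auto
  then show "integrable \<mu> (\<lambda>w. A * exp (m\<^sup>2 / \<alpha>) * exp (- (\<alpha> / 4) * (norm w)\<^sup>2))"
    by (rule integrable_mult_right)
  show "(\<lambda>w. norm (toeplitz_integrand \<alpha> f z w) * exp (b * norm w)) \<in> borel_measurable \<mu>"
    using measurable_toeplitz_integrand[OF f] by measurable
  have "norm (toeplitz_integrand \<alpha> f z w) * exp (b * norm w)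
      \<le> A * exp (m\<^sup>2 / \<alpha>) * exp (- (\<alpha> / 4) * (norm w)\<^sup>2)" for w
  proof -
    have sq: "(norm (w - z))\<^sup>2 = (norm z)\<^sup>2 - 2 * (z \<bullet> w) + (norm w)\<^sup>2"
      by (simp add: power2_norm_eq_inner inner_diff inner_commute)
    have "\<alpha> * (z \<bullet> w) \<le> \<alpha> * (norm z * norm w)"
      using \<alpha> by (intro mult_left_mono norm_cauchy_schwarz) auto
    \<comment> \<open>Young's inequality: the linear exponent \<open>m |w|\<close> costs half of the Gaussian exponent.\<close>
    moreover have "m * norm w \<le> \<alpha> / 4 * (norm w)\<^sup>2 + m\<^sup>2 / \<alpha>"
    proof -
      have "0 \<le> \<alpha> / 4 * (norm w - 2 * m / \<alpha>)\<^sup>2"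
        using \<alpha> by simp
      also have "\<dots> = \<alpha> / 4 * (norm w)\<^sup>2 + m\<^sup>2 / \<alpha> - m * norm w"
        using \<alpha> by (simp add: power2_eq_square field_simps)
      finally show ?thesis
        by simp
    qed
    ultimately have "\<alpha> / 2 * (norm z)\<^sup>2 + - (\<alpha> / 2) * (norm (w - z))\<^sup>2 + b * norm w
        \<le> m\<^sup>2 / \<alpha> + - (\<alpha> / 4) * (norm w)\<^sup>2"
      unfolding sq m_def by (simp add: algebra_simps)
    then have "exp (\<alpha> / 2 * (norm z)\<^sup>2) * exp (- (\<alpha> / 2) * (norm (w - z))\<^sup>2) * exp (b * norm w)
        \<le> exp (m\<^sup>2 / \<alpha>) * exp (- (\<alpha> / 4) * (norm w)\<^sup>2)"
      unfolding exp_add[symmetric] exp_le_cancel_iff .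
    then have "(exp (\<alpha> / 2 * (norm z)\<^sup>2) * exp (- (\<alpha> / 2) * (norm (w - z))\<^sup>2) * exp (b * norm w)) * weighted_modulus \<alpha> f w
        \<le> (exp (m\<^sup>2 / \<alpha>) * exp (- (\<alpha> / 4) * (norm w)\<^sup>2)) * A"
      by (rule mult_mono[OF _ A]) auto
    then show ?thesis
      unfolding norm_toeplitz_integrand by (simp only: mult_ac)
  qed
  then show "AE w in \<mu>. norm (norm (toeplitz_integrand \<alpha> f z w) * exp (b * norm w))
      \<le> norm (A * exp (m\<^sup>2 / \<alpha>) * exp (- (\<alpha> / 4) * (norm w)\<^sup>2))"
    by (intro always_eventually allI) (smt (verit, best) exp_ge_zero mult_nonneg_nonneg norm_ge_zero real_norm_def)
qed

lemma integrable_toeplitz_integrand: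
  fixes \<mu> :: "(complex^'n) measure"
  assumes \<alpha>: "0 < \<alpha>" and sets: "sets \<mu> = sets borel"
    and fin: "(\<integral>\<^sup>+w. ennreal (exp (- (\<alpha> / 4) * (norm w)\<^sup>2)) \<partial>\<mu>) < \<infinity>"
    and f: "f \<in> borel_measurable borel" and A: "\<And>w. weighted_modulus \<alpha> f w \<le> A"
  shows "integrable \<mu> (toeplitz_integrand \<alpha> f z)"
  using integrable_toeplitz_integrand_exp[OF assms, of z 0] measurable_toeplitz_integrand[OF f, of \<alpha> z] sets
  by (simp add: integrable_norm_iff cong: measurable_cong_sets)

text \<open>
  Differentiation under the integral sign.  The increment of the kernel in direction \<open>h\<close> multiplies
  the integrand by \<open>exp a\<close> with \<open>a = \<alpha> \<langle>h, w\<rangle>\<close>, so the error of the linear approximation is governed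
  by \<open>|exp a - 1 - a| \<le> |a|\<^sup>2 exp |a|\<close>, which is quadratic in \<open>h\<close> with an integrable factor.
\<close>

lemma entire_toeplitz:
  fixes \<mu> :: "(complex^'n) measure"
  assumes \<alpha>: "0 < \<alpha>" and sets: "sets \<mu> = sets borel"
    and fin: "(\<integral>\<^sup>+w. ennreal (exp (- (\<alpha> / 4) * (norm w)\<^sup>2)) \<partial>\<mu>) < \<infinity>"
    and f: "f \<in> borel_measurable borel" and A: "\<And>w. weighted_modulus \<alpha> f w \<le> A"
  shows "entire (toeplitz \<alpha> \<mu> f)"
  unfolding entire_def
proof (intro allI exI conjI)
  fix z :: "complex^'n"
  let ?J = "\<lambda>z. toeplitz_integrand \<alpha> f z"
  define D where "D h = (\<integral>w. of_real \<alpha> * hermitian h w * ?J z w \<partial>\<mu>)" for h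
  define E where "E = (\<integral>w. norm (?J z w) * exp ((\<alpha> + 2) * norm w) \<partial>\<mu>)"
  note exp_int = integrable_toeplitz_integrand_exp[OF assms]
  note int_J = integrable_toeplitz_integrand[OF assms]
  have [measurable_cong]: "sets \<mu> = sets borel"
    by (rule sets)
  have [measurable]: "?J z \<in> borel_measurable borel" for z
    by (rule measurable_toeplitz_integrand[OF f])
  have [measurable]: "(\<lambda>w. hermitian h w) \<in> borel_measurable borel" for h :: "complex^'n"
    by (intro borel_measurable_continuous_onI continuous_intros)
  have le_exp: "x \<le> exp x" for x :: real
    using exp_ge_add_one_self[of x] by linarith
  have bound_D: "norm (of_real \<alpha> * hermitian h w * ?J z w) \<le> norm h * (\<alpha> * (norm (?J z w) * exp (1 * norm w)))" for h w
  proof -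
    have "norm (hermitian h w) \<le> norm h * exp (norm w)"
      by (rule order_trans[OF norm_hermitian_le]) (intro mult_left_mono le_exp norm_ge_zero)
    then have "\<alpha> * norm (hermitian h w) * norm (?J z w) \<le> \<alpha> * (norm h * exp (norm w)) * norm (?J z w)"
      using \<alpha> by (intro mult_right_mono mult_left_mono) auto
    then show ?thesis
      using \<alpha> by (simp add: norm_mult mult_ac)
  qed
  have int_bound: "integrable \<mu> (\<lambda>w. norm h * (\<alpha> * (norm (?J z w) * exp (1 * norm w))))" for h :: "complex^'n"
    by (intro integrable_mult_right exp_int)
  have int_D: "integrable \<mu> (\<lambda>w. of_real \<alpha> * hermitian h w * ?J z w)" for h
  proof (rule Bochner_Integration.integrable_bound[OF int_bound[of h]])
    show "AE w in \<mu>. norm (of_real \<alpha> * hermitian h w * ?J z w)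
        \<le> norm (norm h * (\<alpha> * (norm (?J z w) * exp (1 * norm w))))"
      unfolding real_norm_def by (intro always_eventually allI order_trans[OF bound_D abs_ge_self])
  qed measurable
  have D_add: "D (a + b) = D a + D b" for a b
    unfolding D_def Bochner_Integration.integral_add[OF int_D int_D, symmetric]
    by (simp add: hermitian_add_left algebra_simps)
  show D_scale: "D (c *s v) = c * D v" for c v
    unfolding D_def integral_mult_right_zero[symmetric] by (simp add: hermitian_scale_left mult_ac)
  have "bounded_linear D"
  proof (rule bounded_linear_intro)
    show "D (r *\<^sub>R a) = r *\<^sub>R D a" for r a
      by (simp only: scaleR_conv_scale D_scale scaleR_conv_of_real[where 'a=complex])
    show "norm (D h) \<le> norm h * (\<integral>w. \<alpha> * (norm (?J z w) * exp (1 * norm w)) \<partial>\<mu>)" for h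
    proof -
      have "norm (D h) \<le> (\<integral>w. norm h * (\<alpha> * (norm (?J z w) * exp (1 * norm w))) \<partial>\<mu>)"
        unfolding D_def by (rule Bochner_Integration.integral_norm_bound_integral[OF int_D int_bound bound_D])
      then show ?thesis
        by simp
    qed
  qed (rule D_add)
  moreover have "norm (toeplitz \<alpha> \<mu> f y - toeplitz \<alpha> \<mu> f z - D (y - z)) / norm (y - z) \<le> \<alpha>\<^sup>2 * E * norm (y - z)"
    if "y \<noteq> z" "dist y z < 1" for y
  proof -
    define h where "h = y - z"
    have h: "0 < norm h" "norm h \<le> 1"
      using that by (simp_all add: h_def dist_norm)
    have J_shift: "?J y w = exp (of_real \<alpha> * hermitian h w) * ?J z w" for w
      unfolding toeplitz_integrand_def fock_kernel_def
      using hermitian_add_left[of h z w] by (simp add: h_def distrib_left exp_add mult_ac)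
    have "norm (?J y w - ?J z w - of_real \<alpha> * hermitian h w * ?J z w)
        \<le> (norm h)\<^sup>2 * (\<alpha>\<^sup>2 * (norm (?J z w) * exp ((\<alpha> + 2) * norm w)))" for w
    proof -
      define a where "a = of_real \<alpha> * hermitian h w"
      have a: "norm a \<le> \<alpha> * (norm h * norm w)"
        using norm_hermitian_le[of h w] \<alpha> by (simp add: a_def norm_mult)
      also have "\<dots> \<le> \<alpha> * (1 * norm w)"
        using \<alpha> h by (intro mult_left_mono mult_right_mono) auto
      finally have a': "norm a \<le> \<alpha> * norm w"
        by simp
      have "norm (exp a - (1 + a)) \<le> exp (norm a) * (norm a)\<^sup>2"
        using Taylor_exp_field[of a 1] by (simp add: power2_eq_square)
      also have "\<dots> \<le> exp (\<alpha> * norm w) * (\<alpha> * (norm h * norm w))\<^sup>2"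
        using a a' by (intro mult_mono power_mono) auto
      also have "\<dots> \<le> exp (\<alpha> * norm w) * (\<alpha> * (norm h * exp (norm w)))\<^sup>2"
        using \<alpha> by (intro mult_left_mono power_mono le_exp) auto
      also have "\<dots> = (norm h)\<^sup>2 * (\<alpha>\<^sup>2 * exp ((\<alpha> + 2) * norm w))"
        unfolding distrib_right exp_add exp_double by (simp add: power_mult_distrib mult_ac)
      finally have "norm ((exp a - (1 + a)) * ?J z w) \<le> (norm h)\<^sup>2 * (\<alpha>\<^sup>2 * exp ((\<alpha> + 2) * norm w)) * norm (?J z w)"
        unfolding norm_mult by (rule mult_right_mono) simp
      moreover have "?J y w - ?J z w - of_real \<alpha> * hermitian h w * ?J z w = (exp a - (1 + a)) * ?J z w"
        by (simp add: J_shift a_def algebra_simps)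
      ultimately show ?thesis
        by (simp only: mult_ac)
    qed
    then have "norm (\<integral>w. ?J y w - ?J z w - of_real \<alpha> * hermitian h w * ?J z w \<partial>\<mu>)
        \<le> (\<integral>w. (norm h)\<^sup>2 * (\<alpha>\<^sup>2 * (norm (?J z w) * exp ((\<alpha> + 2) * norm w))) \<partial>\<mu>)"
      by (intro Bochner_Integration.integral_norm_bound_integral Bochner_Integration.integrable_diff
            integrable_mult_right exp_int int_J int_D)
    moreover have "(\<integral>w. ?J y w - ?J z w - of_real \<alpha> * hermitian h w * ?J z w \<partial>\<mu>)
        = toeplitz \<alpha> \<mu> f y - toeplitz \<alpha> \<mu> f z - D h"
      unfolding toeplitz_def D_def
      by (subst Bochner_Integration.integral_diff[OF Bochner_Integration.integrable_diff[OF int_J int_J] int_D],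
          subst Bochner_Integration.integral_diff[OF int_J int_J]) (rule refl)
    ultimately have "norm (toeplitz \<alpha> \<mu> f y - toeplitz \<alpha> \<mu> f z - D h) \<le> (norm h)\<^sup>2 * (\<alpha>\<^sup>2 * E)"
      by (simp add: E_def)
    then show ?thesis
      using h unfolding h_def[symmetric] by (simp add: power2_eq_square divide_le_eq mult_ac)
  qed
  moreover have "((\<lambda>y. \<alpha>\<^sup>2 * E * norm (y - z)) \<longlongrightarrow> 0) (at z)"
  proof -
    have "((\<lambda>y. \<alpha>\<^sup>2 * E * norm (y - z)) \<longlongrightarrow> \<alpha>\<^sup>2 * E * norm (z - z)) (at z)"
      by (intro tendsto_intros)
    then show ?thesis
      by simp
  qed
  ultimately show "(toeplitz \<alpha> \<mu> f has_derivative D) (at z)"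
    by (intro has_derivativeI_sandwich[where e = 1 and H = "\<lambda>y. \<alpha>\<^sup>2 * E * norm (y - z)"]) auto
qed

lemma weighted_modulus_toeplitz_le:
  fixes \<mu> :: "(complex^'n) measure"
  assumes sets: "sets \<mu> = sets borel" and int: "integrable \<mu> (toeplitz_integrand \<alpha> f z)"
    and A: "\<And>w. weighted_modulus \<alpha> f w \<le> A"
  shows "ennreal (weighted_modulus \<alpha> (toeplitz \<alpha> \<mu> f) z) \<le> ennreal A * berezin \<alpha> 1 \<mu> z"
proof -
  have "ennreal (weighted_modulus \<alpha> (toeplitz \<alpha> \<mu> f) z)
      = ennreal (exp (- (\<alpha> / 2) * (norm z)\<^sup>2)) * ennreal (norm (\<integral>w. toeplitz_integrand \<alpha> f z w \<partial>\<mu>))"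
    by (simp add: weighted_modulus_def toeplitz_def mult.commute flip: ennreal_mult)
  also have "\<dots> \<le> ennreal (exp (- (\<alpha> / 2) * (norm z)\<^sup>2)) * (\<integral>\<^sup>+w. ennreal (norm (toeplitz_integrand \<alpha> f z w)) \<partial>\<mu>)"
    by (intro mult_left_mono integral_norm_bound_ennreal int) simp
  also have "\<dots> = (\<integral>\<^sup>+w. ennreal (exp (- (\<alpha> / 2) * (norm z)\<^sup>2)) * ennreal (norm (toeplitz_integrand \<alpha> f z w)) \<partial>\<mu>)"
    using int by (intro nn_integral_cmult[symmetric]) simp
  also have "\<dots> \<le> (\<integral>\<^sup>+w. ennreal A * ennreal (exp (- (1 * \<alpha> / 2) * (norm (w - z))\<^sup>2)) \<partial>\<mu>)"
  proof (rule nn_integral_mono)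
    fix w
    have "exp (- (\<alpha> / 2) * (norm z)\<^sup>2) * exp (\<alpha> / 2 * (norm z)\<^sup>2) = 1"
      by (simp flip: exp_add)
    then have "exp (- (\<alpha> / 2) * (norm z)\<^sup>2) * norm (toeplitz_integrand \<alpha> f z w)
        = exp (- (\<alpha> / 2) * (norm (w - z))\<^sup>2) * weighted_modulus \<alpha> f w"
      unfolding norm_toeplitz_integrand mult.assoc[symmetric] by simp
    also have "\<dots> \<le> A * exp (- (\<alpha> / 2) * (norm (w - z))\<^sup>2)"
      using A[of w] by (simp add: mult.commute)
    finally show "ennreal (exp (- (\<alpha> / 2) * (norm z)\<^sup>2)) * ennreal (norm (toeplitz_integrand \<alpha> f z w))
        \<le> ennreal A * ennreal (exp (- (1 * \<alpha> / 2) * (norm (w - z))\<^sup>2))"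
      using order_trans[OF weighted_modulus_nonneg A] by (simp add: ennreal_leI flip: ennreal_mult)
  qed
  also have "\<dots> = ennreal A * berezin \<alpha> 1 \<mu> z"
    unfolding berezin_eq using sets
    by (intro nn_integral_cmult) (auto intro!: borel_measurable_continuous_onI continuous_intros cong: measurable_cong_sets)
  finally show ?thesis .
qed

text \<open>
  At its own centre \<open>w\<close> the integrand of \<open>T\<^sub>\<mu> k\<^sub>w\<close> is a product of a complex number and its conjugate,
  hence positive, so the integral involves no cancellation.
\<close>

lemma weighted_modulus_toeplitz_kernel:
  fixes \<mu> :: "(complex^'n) measure"
  assumes int: "integrable \<mu> (toeplitz_integrand \<alpha> (normalized_fock_kernel \<alpha> w) w)"
  shows "ennreal (weighted_modulus \<alpha> (toeplitz \<alpha> \<mu> (normalized_fock_kernel \<alpha> w)) w) = berezin \<alpha> 2 \<mu> w"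
proof -
  let ?J = "toeplitz_integrand \<alpha> (normalized_fock_kernel \<alpha> w) w"
  define g where "g u = exp (\<alpha> / 2 * (norm w)\<^sup>2) * exp (- \<alpha> * (norm (u - w))\<^sup>2)" for u :: "complex^'n"
  have g: "g u = norm (?J u)" for u
    unfolding norm_toeplitz_integrand weighted_modulus_kernel g_def by (simp flip: exp_add)
  have J: "?J u = of_real (g u)" for u
  proof -
    have "hermitian w u + hermitian u w = of_real (2 * (w \<bullet> u))"
      unfolding hermitian_cnj[of u w] complex_add_cnj Re_hermitian ..
    then have "of_real \<alpha> * hermitian w u + (of_real \<alpha> * hermitian u w - of_real (\<alpha> * (norm w)\<^sup>2 / 2))
        = complex_of_real (\<alpha> * (2 * (w \<bullet> u)) - \<alpha> * (norm w)\<^sup>2 / 2)"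
      by (simp add: algebra_simps flip: distrib_left)
    then have "fock_kernel \<alpha> u w * normalized_fock_kernel \<alpha> w u
        = of_real (exp (\<alpha> * (2 * (w \<bullet> u)) - \<alpha> * (norm w)\<^sup>2 / 2))"
      unfolding fock_kernel_def normalized_fock_kernel_def exp_add[symmetric] by (simp only: exp_of_real)
    then have "?J u = of_real (exp (\<alpha> * (2 * (w \<bullet> u)) - \<alpha> * (norm w)\<^sup>2 / 2) * exp (- \<alpha> * (norm u)\<^sup>2))"
      unfolding toeplitz_integrand_def by simp
    then show ?thesis
      unfolding g by (simp only: norm_of_real abs_mult abs_exp_cancel)
  qed
  have "integrable \<mu> (\<lambda>u. norm (?J u))"
    by (rule integrable_norm[OF int])
  then have int_g: "integrable \<mu> g"
    unfolding g[abs_def] .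
  have "toeplitz \<alpha> \<mu> (normalized_fock_kernel \<alpha> w) w = of_real (\<integral>u. g u \<partial>\<mu>)"
    unfolding toeplitz_def J by simp
  moreover have "0 \<le> (\<integral>u. g u \<partial>\<mu>)"
    unfolding g by simp
  ultimately have "ennreal (weighted_modulus \<alpha> (toeplitz \<alpha> \<mu> (normalized_fock_kernel \<alpha> w)) w)
      = ennreal (exp (- (\<alpha> / 2) * (norm w)\<^sup>2)) * ennreal (\<integral>u. g u \<partial>\<mu>)"
    by (simp add: weighted_modulus_def mult.commute flip: ennreal_mult)
  also have "ennreal (\<integral>u. g u \<partial>\<mu>) = (\<integral>\<^sup>+u. ennreal (g u) \<partial>\<mu>)"
    by (rule nn_integral_eq_integral[symmetric, OF int_g]) (simp add: g)
  also have "ennreal (exp (- (\<alpha> / 2) * (norm w)\<^sup>2)) * \<dots>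
      = (\<integral>\<^sup>+u. ennreal (exp (- (\<alpha> / 2) * (norm w)\<^sup>2)) * ennreal (g u) \<partial>\<mu>)"
    using int_g by (intro nn_integral_cmult[symmetric]) simp
  also have "\<dots> = (\<integral>\<^sup>+u. ennreal (exp (- (2 * \<alpha> / 2) * (norm (u - w))\<^sup>2)) \<partial>\<mu>)"
    unfolding g_def by (simp flip: ennreal_mult exp_add)
  finally show ?thesis
    unfolding berezin_eq .
qed

section \<open>Comparison with the mass of unit balls\<close>

lemma comparableI:
  assumes "A \<le> ennreal C * B" "B \<le> ennreal D * A" "0 \<le> C" "0 \<le> D"
  shows "comparable (C + D) A B"
  unfolding comparable_def
proof
  show "A \<le> ennreal (C + D) * B"
    using assms by (intro order_trans[OF assms(1)] mult_right_mono ennreal_leI) auto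
  show "B \<le> ennreal (C + D) * A"
    using assms by (intro order_trans[OF assms(2)] mult_right_mono ennreal_leI) auto
qed

lemma comparable_sym: "comparable C A B \<Longrightarrow> comparable C B A"
  by (auto simp: comparable_def)

lemma comparable_trans:
  assumes AB: "comparable C A B" and BE: "comparable D B E" and pos: "0 < C" "0 < D"
  shows "comparable (C * D) A E"
  unfolding comparable_def
proof
  have "A \<le> ennreal C * B"
    using AB by (simp add: comparable_def)
  also have "\<dots> \<le> ennreal C * (ennreal D * E)"
    using BE by (intro mult_left_mono) (simp_all add: comparable_def)
  finally have "A \<le> ennreal C * (ennreal D * E)" .
  then show "A \<le> ennreal (C * D) * E"
    using pos by (simp add: ennreal_mult mult.assoc)
  have "E \<le> ennreal D * B"
    using BE by (simp add: comparable_def)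
  also have "\<dots> \<le> ennreal D * (ennreal C * A)"
    using AB by (intro mult_left_mono) (simp_all add: comparable_def)
  finally have "E \<le> ennreal D * (ennreal C * A)" .
  then show "E \<le> ennreal (C * D) * A"
    using pos by (simp add: ennreal_mult mult_ac)
qed

lemma comparable_mono:
  assumes "C \<le> D" "comparable C A B"
  shows "comparable D A B"
  using assms ennreal_leI[OF assms(1)] unfolding comparable_def
  by (meson mult_right_mono order_trans zero_le)

lemma comparable_finite_iff: "comparable C A B \<Longrightarrow> A < \<infinity> \<longleftrightarrow> B < \<infinity>"
  by (auto simp: comparable_def ennreal_mult_less_top intro: le_less_trans)

text \<open>
  The reference quantity.  It is a plain supremum, not an essential one, so that it bounds the mass
  of each individual ball.
\<close>

definition sup_ball_mass :: "(complex^'n) measure \<Rightarrow> ennreal" where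
  "sup_ball_mass \<mu> = (SUP z. emeasure \<mu> (ball z 1))"

lemma emeasure_ball_le_sup_ball_mass: "emeasure \<mu> (ball z 1) \<le> sup_ball_mass \<mu>"
  unfolding sup_ball_mass_def by (rule SUP_upper) simp

lemma Linf_norm_le:
  "g \<in> borel_measurable borel \<Longrightarrow> (\<And>z. g z \<le> B) \<Longrightarrow> Linf_norm g \<le> B"
  unfolding Linf_norm_def by (intro esssup_I) auto

lemma emeasure_ball_le_mult_sup_ball_mass:
  "\<exists>C>0. \<forall>\<mu> :: (complex^'n) measure. sets \<mu> = sets borel \<longrightarrow> sigma_finite_measure \<mu> \<longrightarrow>
    (\<forall>z. emeasure \<mu> (ball z \<delta>) \<le> ennreal C * sup_ball_mass \<mu>)"
proof -
  obtain C where C: "C > 0" "\<And>\<mu> :: (complex^'n) measure. \<And>z. sets \<mu> = sets borel \<Longrightarrow>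
      emeasure \<mu> (ball z \<delta>) \<le> ennreal C * Linf_norm (\<lambda>u. emeasure \<mu> (ball u 1))"
    using emeasure_ball_le_Linf_norm[of 1 \<delta>, where 'n='n] by auto
  show ?thesis
  proof (intro exI[of _ C] conjI allI impI C(1))
    fix \<mu> :: "(complex^'n) measure" and z
    assume sets: "sets \<mu> = sets borel" and fin: "sigma_finite_measure \<mu>"
    have "Linf_norm (\<lambda>u. emeasure \<mu> (ball u 1)) \<le> sup_ball_mass \<mu>"
      by (intro Linf_norm_le measurable_emeasure_ball sets fin emeasure_ball_le_sup_ball_mass)
    then show "emeasure \<mu> (ball z \<delta>) \<le> ennreal C * sup_ball_mass \<mu>"
      by (intro order_trans[OF C(2)[OF sets]] mult_left_mono) auto
  qed
qed

lemma sup_ball_mass_le_Linf_norm: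
  assumes "0 < \<delta>"
  shows "\<exists>C>0. \<forall>\<mu> :: (complex^'n) measure. sets \<mu> = sets borel \<longrightarrow>
    sup_ball_mass \<mu> \<le> ennreal C * Linf_norm (\<lambda>u. emeasure \<mu> (ball u \<delta>))"
  using emeasure_ball_le_Linf_norm[OF assms, of 1, where 'n='n]
  unfolding sup_ball_mass_def by (meson SUP_least)

lemma comparable_Linf_norm_emeasure_ball:
  assumes "0 < \<delta>"
  shows "\<exists>C>0. \<forall>\<mu> :: (complex^'n) measure. sets \<mu> = sets borel \<longrightarrow> sigma_finite_measure \<mu> \<longrightarrow>
    comparable C (Linf_norm (\<lambda>z. emeasure \<mu> (ball z \<delta>))) (sup_ball_mass \<mu>)"
proof -
  obtain C where C: "C > 0" "\<And>\<mu> :: (complex^'n) measure. \<And>z. sets \<mu> = sets borel \<Longrightarrow> sigma_finite_measure \<mu> \<Longrightarrow>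
      emeasure \<mu> (ball z \<delta>) \<le> ennreal C * sup_ball_mass \<mu>"
    using emeasure_ball_le_mult_sup_ball_mass[of \<delta>, where 'n='n] by auto
  obtain D where D: "D > 0" "\<And>\<mu> :: (complex^'n) measure. sets \<mu> = sets borel \<Longrightarrow>
      sup_ball_mass \<mu> \<le> ennreal D * Linf_norm (\<lambda>u. emeasure \<mu> (ball u \<delta>))"
    using sup_ball_mass_le_Linf_norm[OF assms, where 'n='n] by auto
  show ?thesis
    using C D
    by (intro exI[of _ "C + D"] conjI allI impI comparableI Linf_norm_le measurable_emeasure_ball) auto
qed

text \<open>
  Every point lies within \<open>r / 2\<close> of a lattice point, so each ball of radius \<open>r / 2\<close> is contained in a
  ball of radius \<open>r\<close> around a lattice point.
\<close>

lemma comparable_linf_norm_lattice: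
  fixes lat :: "nat \<Rightarrow> complex^'n"
  assumes r: "0 < r" and lat: "half_lattice r lat"
  shows "\<exists>C>0. \<forall>\<mu> :: (complex^'n) measure. sets \<mu> = sets borel \<longrightarrow> sigma_finite_measure \<mu> \<longrightarrow>
    comparable C (linf_norm (\<lambda>k. emeasure \<mu> (ball (lat k) r))) (sup_ball_mass \<mu>)"
proof -
  obtain C where C: "C > 0" "\<And>\<mu> :: (complex^'n) measure. \<And>z. sets \<mu> = sets borel \<Longrightarrow> sigma_finite_measure \<mu> \<Longrightarrow>
      emeasure \<mu> (ball z r) \<le> ennreal C * sup_ball_mass \<mu>"
    using emeasure_ball_le_mult_sup_ball_mass[of r, where 'n='n] by auto
  obtain D where D: "D > 0" "\<And>\<mu> :: (complex^'n) measure. sets \<mu> = sets borel \<Longrightarrow>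
      sup_ball_mass \<mu> \<le> ennreal D * Linf_norm (\<lambda>u. emeasure \<mu> (ball u (r / 2)))"
    using sup_ball_mass_le_Linf_norm[of "r / 2", where 'n='n] r by auto
  show ?thesis
  proof (intro exI[of _ "C + D"] conjI allI impI comparableI)
    fix \<mu> :: "(complex^'n) measure"
    assume sets: "sets \<mu> = sets borel" and fin: "sigma_finite_measure \<mu>"
    let ?l = "linf_norm (\<lambda>k. emeasure \<mu> (ball (lat k) r))"
    show "?l \<le> ennreal C * sup_ball_mass \<mu>"
      unfolding linf_norm_def by (intro SUP_least C(2) sets fin)
    have "emeasure \<mu> (ball u (r / 2)) \<le> ?l" for u
    proof -
      obtain k where k: "dist (lat k) u < r / 2"
        using lat unfolding half_lattice_def by (metis UNIV_I UN_E mem_ball)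
      have "ball u (r / 2) \<subseteq> ball (lat k) r"
      proof
        fix x assume "x \<in> ball u (r / 2)"
        then show "x \<in> ball (lat k) r"
          using k dist_triangle[of "lat k" x u] by simp
      qed
      then have "emeasure \<mu> (ball u (r / 2)) \<le> emeasure \<mu> (ball (lat k) r)"
        using sets by (intro emeasure_mono) simp_all
      also have "\<dots> \<le> ?l"
        unfolding linf_norm_def by (rule SUP_upper) simp
      finally show ?thesis .
    qed
    then have "Linf_norm (\<lambda>u. emeasure \<mu> (ball u (r / 2))) \<le> ?l"
      by (intro Linf_norm_le measurable_emeasure_ball sets fin)
    then show "sup_ball_mass \<mu> \<le> ennreal D * ?l"
      by (intro order_trans[OF D(2)[OF sets]] mult_left_mono) auto
  qed (use C D in auto)
qed

lemma berezin_le_sup_ball_mass: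
  assumes "0 < \<alpha>" "0 < t"
  shows "\<exists>C>0. \<forall>\<mu> :: (complex^'n) measure. sets \<mu> = sets borel \<longrightarrow> sigma_finite_measure \<mu> \<longrightarrow>
    (\<forall>w. berezin \<alpha> t \<mu> w \<le> ennreal C * sup_ball_mass \<mu>)"
proof -
  define c where "c = t * \<alpha> / 2"
  have c: "0 < c"
    using assms by (simp add: c_def)
  have "0 < exp c * sqrt (2 * pi / c) ^ DIM(complex^'n) / unit_ball_vol DIM(complex^'n)"
    using c by (intro divide_pos_pos mult_pos_pos unit_ball_vol_pos zero_less_power) auto
  then show ?thesis
    unfolding berezin_eq c_def[symmetric]
    by (intro exI[of _ "exp c * sqrt (2 * pi / c) ^ DIM(complex^'n) / unit_ball_vol DIM(complex^'n)"]
          conjI allI impI gaussian_average_le[OF c] emeasure_ball_le_sup_ball_mass)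
qed

lemma sup_ball_mass_le_berezin:
  assumes "0 < \<alpha>" "0 < t" "sets \<mu> = sets borel" and B: "\<And>w. berezin \<alpha> t \<mu> w \<le> B"
  shows "sup_ball_mass \<mu> \<le> ennreal (exp (t * \<alpha> / 2)) * B"
  unfolding sup_ball_mass_def
proof (rule SUP_least)
  fix w
  show "emeasure \<mu> (ball w 1) \<le> ennreal (exp (t * \<alpha> / 2)) * B"
    using emeasure_ball_le_berezin[OF assms(1-3), of w 1] mult_left_mono[OF B[of w], of "ennreal (exp (t * \<alpha> / 2))"]
    by simp
qed

lemma measurable_berezin:
  "sets \<mu> = sets borel \<Longrightarrow> sigma_finite_measure \<mu> \<Longrightarrow> berezin \<alpha> t \<mu> \<in> borel_measurable borel"
  unfolding berezin_eq[abs_def] by (rule measurable_gaussian_average)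

lemma comparable_Linf_norm_berezin:
  assumes "0 < \<alpha>" "0 < t"
  shows "\<exists>C>0. \<forall>\<mu> :: (complex^'n) measure. sets \<mu> = sets borel \<longrightarrow> sigma_finite_measure \<mu> \<longrightarrow>
    comparable C (Linf_norm (berezin \<alpha> t \<mu>)) (sup_ball_mass \<mu>)"
proof -
  obtain C where C: "C > 0" "\<And>\<mu> :: (complex^'n) measure. \<And>w. sets \<mu> = sets borel \<Longrightarrow> sigma_finite_measure \<mu> \<Longrightarrow>
      berezin \<alpha> t \<mu> w \<le> ennreal C * sup_ball_mass \<mu>"
    using berezin_le_sup_ball_mass[OF assms, where 'n='n] by auto
  obtain D where D: "D > 0" "\<And>\<mu> :: (complex^'n) measure. sets \<mu> = sets borel \<Longrightarrow>
      sup_ball_mass \<mu> \<le> ennreal D * Linf_norm (\<lambda>u. emeasure \<mu> (ball u 1))"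
    using sup_ball_mass_le_Linf_norm[of 1, where 'n='n] by auto
  define e where "e = exp (t * \<alpha> / 2)"
  show ?thesis
  proof (intro exI[of _ "C + D * e"] conjI allI impI comparableI)
    fix \<mu> :: "(complex^'n) measure"
    assume sets: "sets \<mu> = sets borel" and fin: "sigma_finite_measure \<mu>"
    show "Linf_norm (berezin \<alpha> t \<mu>) \<le> ennreal C * sup_ball_mass \<mu>"
      by (intro Linf_norm_le measurable_berezin sets fin C(2))
    have "AE w in lborel. emeasure \<mu> (ball w 1) \<le> ennreal e * Linf_norm (berezin \<alpha> t \<mu>)"
      using esssup_AE[where M = lborel and f = "berezin \<alpha> t \<mu>"]
    proof eventually_elim
      case (elim w)
      have "emeasure \<mu> (ball w 1) \<le> ennreal e * berezin \<alpha> t \<mu> w"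
        using emeasure_ball_le_berezin[OF assms sets, of w 1] by (simp add: e_def)
      also have "\<dots> \<le> ennreal e * Linf_norm (berezin \<alpha> t \<mu>)"
        unfolding Linf_norm_def by (rule mult_left_mono[OF elim]) simp
      finally show ?case .
    qed
    then have "Linf_norm (\<lambda>u. emeasure \<mu> (ball u 1)) \<le> ennreal e * Linf_norm (berezin \<alpha> t \<mu>)"
      unfolding Linf_norm_def[of "\<lambda>u. emeasure \<mu> (ball u 1)"]
      using measurable_emeasure_ball[OF sets fin] by (intro esssup_I) auto
    then have "ennreal D * Linf_norm (\<lambda>u. emeasure \<mu> (ball u 1)) \<le> ennreal D * (ennreal e * Linf_norm (berezin \<alpha> t \<mu>))"
      by (rule mult_left_mono) simp
    then show "sup_ball_mass \<mu> \<le> ennreal (D * e) * Linf_norm (berezin \<alpha> t \<mu>)"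
      using D(2)[OF sets] D(1) by (simp add: ennreal_mult e_def mult.assoc)
  qed (use C D in \<open>auto simp: e_def add_pos_pos\<close>)
qed

section \<open>Bounds for the Toeplitz operator\<close>

lemma fock_norm_infinity: "fock_norm \<alpha> \<infinity> g = (SUP z. weighted_modulus \<alpha> g z)"
  by (simp add: fock_norm_def weighted_modulus_def)

lemma weighted_modulus_le_fock_norm_infinity:
  "g \<in> fock_space \<alpha> \<infinity> \<Longrightarrow> weighted_modulus \<alpha> g z \<le> fock_norm \<alpha> \<infinity> g"
  unfolding fock_norm_infinity by (rule cSUP_upper) (simp_all add: fock_space_def weighted_modulus_def)

lemma toeplitz_bounded_of_finite_mass:
  assumes \<alpha>: "0 < \<alpha>" and p: "1 \<le> p"
  shows "\<exists>C>0. \<forall>\<mu> :: (complex^'n) measure. sets \<mu> = sets borel \<longrightarrow> sigma_finite_measure \<mu> \<longrightarrow>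
    sup_ball_mass \<mu> < \<infinity> \<longrightarrow>
    toeplitz_bounded \<alpha> (ennreal p) \<infinity> \<mu> \<and> toeplitz_norm \<alpha> (ennreal p) \<infinity> \<mu> \<le> ennreal C * sup_ball_mass \<mu>"
proof -
  obtain C where C: "C > 0" "\<And>f. \<And>z :: complex^'n. f \<in> fock_space \<alpha> (ennreal p) \<Longrightarrow>
      weighted_modulus \<alpha> f z \<le> C * fock_norm \<alpha> (ennreal p) f"
    using weighted_modulus_le_fock_norm[OF \<alpha> p, where 'n='n] by auto
  obtain D where D: "D > 0" "\<And>\<mu> :: (complex^'n) measure. \<And>w. sets \<mu> = sets borel \<Longrightarrow> sigma_finite_measure \<mu> \<Longrightarrow>
      berezin \<alpha> 1 \<mu> w \<le> ennreal D * sup_ball_mass \<mu>"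
    using berezin_le_sup_ball_mass[OF \<alpha>, of 1, where 'n='n] by auto
  \<comment> \<open>At the origin the transform with parameter 1/2 is the integral of \<open>exp (- \<alpha> |w|\<^sup>2 / 4)\<close>, the
    Gaussian needed to differentiate under the integral sign.\<close>
  obtain D' where D': "\<And>\<mu> :: (complex^'n) measure. \<And>w. sets \<mu> = sets borel \<Longrightarrow> sigma_finite_measure \<mu> \<Longrightarrow>
      berezin \<alpha> (1 / 2) \<mu> w \<le> ennreal D' * sup_ball_mass \<mu>"
    using berezin_le_sup_ball_mass[OF \<alpha>, of "1 / 2", where 'n='n] by auto
  show ?thesis
  proof (intro exI[of _ "C * D"] conjI allI impI)
    fix \<mu> :: "(complex^'n) measure"
    assume sets: "sets \<mu> = sets borel" and fin: "sigma_finite_measure \<mu>" and "sup_ball_mass \<mu> < \<infinity>"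
    then obtain s where s: "0 \<le> s" "sup_ball_mass \<mu> = ennreal s"
      by (cases "sup_ball_mass \<mu>") auto
    have gauss: "(\<integral>\<^sup>+w. ennreal (exp (- (\<alpha> / 4) * (norm w)\<^sup>2)) \<partial>\<mu>) < \<infinity>"
      using D'[OF sets fin, of 0] s
      by (auto simp: berezin_eq ennreal_mult_less_top intro: le_less_trans)
    have main: "(\<forall>z. integrable \<mu> (toeplitz_integrand \<alpha> f z)) \<and> entire (toeplitz \<alpha> \<mu> f) \<and>
        (\<forall>z. weighted_modulus \<alpha> (toeplitz \<alpha> \<mu> f) z \<le> C * D * s * fock_norm \<alpha> (ennreal p) f)"
      if f: "f \<in> fock_space \<alpha> (ennreal p)" for f :: "complex^'n \<Rightarrow> complex"
    proof (intro conjI allI)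
      note meas = entire_imp_measurable[OF fock_space_entire[OF f]]
      show int: "integrable \<mu> (toeplitz_integrand \<alpha> f z)" for z
        by (rule integrable_toeplitz_integrand[OF \<alpha> sets gauss meas C(2)[OF f]])
      show "entire (toeplitz \<alpha> \<mu> f)"
        by (rule entire_toeplitz[OF \<alpha> sets gauss meas C(2)[OF f]])
      fix z
      have "ennreal (weighted_modulus \<alpha> (toeplitz \<alpha> \<mu> f) z) \<le> ennreal (C * fock_norm \<alpha> (ennreal p) f) * berezin \<alpha> 1 \<mu> z"
        by (rule weighted_modulus_toeplitz_le[OF sets int C(2)[OF f]])
      also have "\<dots> \<le> ennreal (C * fock_norm \<alpha> (ennreal p) f) * (ennreal D * ennreal s)"
        using D(2)[OF sets fin, of z] s by (intro mult_left_mono) auto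
      also have "\<dots> = ennreal (C * D * s * fock_norm \<alpha> (ennreal p) f)"
        using C D s by (simp add: ennreal_mult[symmetric] mult_ac)
      finally show "weighted_modulus \<alpha> (toeplitz \<alpha> \<mu> f) z \<le> C * D * s * fock_norm \<alpha> (ennreal p) f"
        using C D s by (simp add: ennreal_le_iff)
    qed
    have in_space: "toeplitz \<alpha> \<mu> f \<in> fock_space \<alpha> \<infinity>" if "f \<in> fock_space \<alpha> (ennreal p)" for f :: "complex^'n \<Rightarrow> complex"
      using main[OF that] unfolding fock_space_def weighted_modulus_def[symmetric]
      by (auto simp: bdd_above_def)
    have norm_le: "fock_norm \<alpha> \<infinity> (toeplitz \<alpha> \<mu> f) \<le> C * D * s * fock_norm \<alpha> (ennreal p) f"
      if "f \<in> fock_space \<alpha> (ennreal p)" for f :: "complex^'n \<Rightarrow> complex"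
      unfolding fock_norm_infinity using main[OF that] by (intro cSUP_least) auto
    show "toeplitz_bounded \<alpha> (ennreal p) \<infinity> \<mu>"
      unfolding toeplitz_bounded_def using main in_space norm_le by blast
    show "toeplitz_norm \<alpha> (ennreal p) \<infinity> \<mu> \<le> ennreal (C * D) * sup_ball_mass \<mu>"
      unfolding toeplitz_norm_def operator_norm_def
    proof (rule SUP_least)
      fix f :: "complex^'n \<Rightarrow> complex"
      assume "f \<in> {f \<in> fock_space \<alpha> (ennreal p). fock_norm \<alpha> (ennreal p) f \<le> 1}"
      then have f: "f \<in> fock_space \<alpha> (ennreal p)" "fock_norm \<alpha> (ennreal p) f \<le> 1"
        by auto
      have "C * D * s * fock_norm \<alpha> (ennreal p) f \<le> C * D * s"
        using f C D s by (intro mult_left_le) auto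
      then have "ennreal (fock_norm \<alpha> \<infinity> (toeplitz \<alpha> \<mu> f)) \<le> ennreal (C * D * s)"
        using norm_le[OF f(1)] by (intro ennreal_leI) simp
      then show "ennreal (fock_norm \<alpha> \<infinity> (toeplitz \<alpha> \<mu> f)) \<le> ennreal (C * D) * sup_ball_mass \<mu>"
        using C D s by (simp add: ennreal_mult)
    qed
  qed (use C D in simp)
qed

lemma berezin_le_toeplitz_norm:
  fixes \<mu> :: "(complex^'n) measure"
  assumes \<alpha>: "0 < \<alpha>" and p: "0 < p" and T: "toeplitz_bounded \<alpha> (ennreal p) \<infinity> \<mu>"
  shows "berezin \<alpha> 2 \<mu> w \<le> toeplitz_norm \<alpha> (ennreal p) \<infinity> \<mu>"
proof -
  let ?k = "normalized_fock_kernel \<alpha> w"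
  note k = normalized_fock_kernel_norm[OF \<alpha> p, of w]
  have int: "integrable \<mu> (toeplitz_integrand \<alpha> ?k w)" and Tk: "toeplitz \<alpha> \<mu> ?k \<in> fock_space \<alpha> \<infinity>"
    using T k unfolding toeplitz_bounded_def by blast+
  have "berezin \<alpha> 2 \<mu> w = ennreal (weighted_modulus \<alpha> (toeplitz \<alpha> \<mu> ?k) w)"
    by (rule weighted_modulus_toeplitz_kernel[OF int, symmetric])
  also have "\<dots> \<le> ennreal (fock_norm \<alpha> \<infinity> (toeplitz \<alpha> \<mu> ?k))"
    by (intro ennreal_leI weighted_modulus_le_fock_norm_infinity Tk)
  also have "\<dots> \<le> toeplitz_norm \<alpha> (ennreal p) \<infinity> \<mu>"
    unfolding toeplitz_norm_def operator_norm_def using k by (intro SUP_upper) auto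
  finally show ?thesis .
qed

lemma toeplitz_norm_finite:
  fixes \<mu> :: "(complex^'n) measure"
  assumes "toeplitz_bounded \<alpha> (ennreal p) \<infinity> \<mu>"
  shows "toeplitz_norm \<alpha> (ennreal p) \<infinity> \<mu> < \<infinity>"
proof -
  obtain C where C: "\<And>f. f \<in> fock_space \<alpha> (ennreal p) \<Longrightarrow>
      fock_norm \<alpha> \<infinity> (toeplitz \<alpha> \<mu> f) \<le> C * fock_norm \<alpha> (ennreal p) f"
    using assms unfolding toeplitz_bounded_def by blast
  have "toeplitz_norm \<alpha> (ennreal p) \<infinity> \<mu> \<le> ennreal \<bar>C\<bar>"
    unfolding toeplitz_norm_def operator_norm_def
  proof (rule SUP_least)
    fix f :: "complex^'n \<Rightarrow> complex"
      assume "f \<in> {f \<in> fock_space \<alpha> (ennreal p). fock_norm \<alpha> (ennreal p) f \<le> 1}"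
    then have f: "f \<in> fock_space \<alpha> (ennreal p)" "fock_norm \<alpha> (ennreal p) f \<le> 1"
      by auto
    have "C * fock_norm \<alpha> (ennreal p) f \<le> \<bar>C\<bar> * 1"
      using f by (intro mult_mono) auto
    then show "ennreal (fock_norm \<alpha> \<infinity> (toeplitz \<alpha> \<mu> f)) \<le> ennreal \<bar>C\<bar>"
      using C[OF f(1)] by (intro ennreal_leI) simp
  qed
  then show ?thesis
    by (auto intro: le_less_trans)
qed

lemma comparable_toeplitz_norm:
  assumes \<alpha>: "0 < \<alpha>" and p: "1 \<le> p"
  shows "\<exists>C>0. \<forall>\<mu> :: (complex^'n) measure. sets \<mu> = sets borel \<longrightarrow> sigma_finite_measure \<mu> \<longrightarrow>
    (toeplitz_bounded \<alpha> (ennreal p) \<infinity> \<mu> \<longleftrightarrow> sup_ball_mass \<mu> < \<infinity>) \<and>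
    (toeplitz_bounded \<alpha> (ennreal p) \<infinity> \<mu> \<longrightarrow> comparable C (toeplitz_norm \<alpha> (ennreal p) \<infinity> \<mu>) (sup_ball_mass \<mu>))"
proof -
  obtain C where C: "C > 0" "\<And>\<mu> :: (complex^'n) measure. sets \<mu> = sets borel \<Longrightarrow> sigma_finite_measure \<mu> \<Longrightarrow>
      sup_ball_mass \<mu> < \<infinity> \<Longrightarrow>
      toeplitz_bounded \<alpha> (ennreal p) \<infinity> \<mu> \<and> toeplitz_norm \<alpha> (ennreal p) \<infinity> \<mu> \<le> ennreal C * sup_ball_mass \<mu>"
    using toeplitz_bounded_of_finite_mass[OF assms, where 'n='n] by auto
  define e where "e = exp (2 * \<alpha> / 2)"
  have lower: "sup_ball_mass \<mu> \<le> ennreal e * toeplitz_norm \<alpha> (ennreal p) \<infinity> \<mu>"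
    if "sets \<mu> = sets borel" "toeplitz_bounded \<alpha> (ennreal p) \<infinity> \<mu>" for \<mu> :: "(complex^'n) measure"
    unfolding e_def using p that by (intro sup_ball_mass_le_berezin berezin_le_toeplitz_norm \<alpha>) auto
  have mass: "sup_ball_mass \<mu> < \<infinity>"
    if "sets \<mu> = sets borel" "toeplitz_bounded \<alpha> (ennreal p) \<infinity> \<mu>" for \<mu> :: "(complex^'n) measure"
    using lower[OF that] toeplitz_norm_finite[OF that(2)]
    by (auto simp: ennreal_mult_less_top intro: le_less_trans)
  show ?thesis
  proof (intro exI[of _ "C + e"] conjI allI impI)
    show "0 < C + e"
      using C by (simp add: e_def add_pos_pos)
    fix \<mu> :: "(complex^'n) measure"
    assume \<mu>: "sets \<mu> = sets borel" "sigma_finite_measure \<mu>"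
    show "toeplitz_bounded \<alpha> (ennreal p) \<infinity> \<mu> \<longleftrightarrow> sup_ball_mass \<mu> < \<infinity>"
      using mass C(2) \<mu> by blast
    assume T: "toeplitz_bounded \<alpha> (ennreal p) \<infinity> \<mu>"
    then show "comparable (C + e) (toeplitz_norm \<alpha> (ennreal p) \<infinity> \<mu>) (sup_ball_mass \<mu>)"
      using C(1) C(2)[OF \<mu> mass[OF \<mu>(1) T]] lower[OF \<mu>(1) T] by (intro comparableI) (auto simp: e_def)
  qed
qed

section \<open>Carleson measures\<close>

lemma nn_integral_weighted_modulus_le_mass:
  assumes \<alpha>: "0 < \<alpha>"
  shows "\<exists>C>0. \<forall>\<mu> :: (complex^'n) measure. sets \<mu> = sets borel \<longrightarrow> sigma_finite_measure \<mu> \<longrightarrow>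
    (\<forall>f\<in>fock_space \<alpha> 1. (\<integral>\<^sup>+z. ennreal (weighted_modulus \<alpha> f z) \<partial>\<mu>)
       \<le> ennreal (C * fock_norm \<alpha> 1 f) * sup_ball_mass \<mu>)"
proof -
  define V where "V = unit_ball_vol (real DIM(complex^'n))"
  have V: "0 < V" and Vball: "emeasure lborel (ball (0 :: complex^'n) 1) = ennreal V"
    unfolding V_def by (rule unit_ball_vol_pos) (simp_all add: emeasure_ball)
  define c where "c = (\<alpha> * 1 / (2 * pi)) ^ CARD('n)"
  have c: "0 < c"
    using \<alpha> by (simp add: c_def)
  show ?thesis
  proof (intro exI[of _ "exp (\<alpha> / 2) / (c * V)"] conjI allI impI ballI)
    fix \<mu> :: "(complex^'n) measure" and f :: "complex^'n \<Rightarrow> complex"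
    assume sets: "sets \<mu> = sets borel" and fin: "sigma_finite_measure \<mu>" and f: "f \<in> fock_space \<alpha> 1"
    let ?I = "\<integral>\<^sup>+z. ennreal (weighted_modulus \<alpha> f z) \<partial>\<mu>"
    define N where "N = fock_norm \<alpha> 1 f"
    have N: "0 \<le> N"
      using fock_norm_nonneg[of \<alpha> 1 f] by (simp add: N_def)
    have meas: "(\<lambda>z. ennreal (weighted_modulus \<alpha> f z)) \<in> borel_measurable borel"
      using entire_imp_measurable[OF fock_space_entire[OF f]] by measurable
    have int: "(\<integral>\<^sup>+z. ennreal (weighted_modulus \<alpha> f z) \<partial>lborel) = ennreal (N / c)"
      using nn_integral_weighted_modulus[OF \<alpha>, of 1 f] f N by (simp add: N_def c_def)
    have "?I * ennreal V \<le> ennreal (exp (\<alpha> / 2)) * sup_ball_mass \<mu> * ennreal (N / c)"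
      using nn_integral_le_of_ball_mean[OF sets fin emeasure_ball_le_sup_ball_mass meas meas
          weighted_modulus_le_ball_mean[OF \<alpha> fock_space_entire[OF f]]]
      unfolding int Vball .
    then have "?I * ennreal V * ennreal (1 / V) \<le> ennreal (exp (\<alpha> / 2)) * sup_ball_mass \<mu> * ennreal (N / c) * ennreal (1 / V)"
      by (rule mult_right_mono) simp
    moreover have "?I * ennreal V * ennreal (1 / V) = ?I"
      using V by (simp add: mult.assoc flip: ennreal_mult)
    moreover have "ennreal (exp (\<alpha> / 2)) * sup_ball_mass \<mu> * ennreal (N / c) * ennreal (1 / V)
        = ennreal (exp (\<alpha> / 2) / (c * V) * N) * sup_ball_mass \<mu>"
    proof -
      have "exp (\<alpha> / 2) / (c * V) * N = exp (\<alpha> / 2) * (N / c) * (1 / V)"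
        by simp
      then have "ennreal (exp (\<alpha> / 2) / (c * V) * N) = ennreal (exp (\<alpha> / 2)) * ennreal (N / c) * ennreal (1 / V)"
        using V c N by (simp only: ennreal_mult divide_nonneg_pos mult_nonneg_nonneg exp_ge_zero zero_le_one)
      then show ?thesis
        by (simp only: mult_ac)
    qed
    ultimately show "?I \<le> ennreal (exp (\<alpha> / 2) / (c * V) * fock_norm \<alpha> 1 f) * sup_ball_mass \<mu>"
      by (simp add: N_def)
  qed (use V c in simp)
qed

text \<open>
  The case \<open>q = 1\<close> is the preceding lemma.  For larger \<open>q\<close>, all but one power of the weighted modulus is
  estimated by its supremum, which is at most a multiple of the norm.
\<close>

lemma fock_carleson_of_finite_mass:
  fixes \<mu> :: "(complex^'n) measure"
  assumes \<alpha>: "0 < \<alpha>" and q: "1 \<le> q" and sets: "sets \<mu> = sets borel" and fin: "sigma_finite_measure \<mu>"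
    and mass: "sup_ball_mass \<mu> < \<infinity>"
  shows "fock_carleson \<alpha> 1 q \<mu>"
proof -
  obtain C where C: "C > 0" "\<And>f. \<And>z :: complex^'n. f \<in> fock_space \<alpha> 1 \<Longrightarrow>
      weighted_modulus \<alpha> f z \<le> C * fock_norm \<alpha> 1 f"
    using weighted_modulus_le_fock_norm[OF \<alpha>, of 1, where 'n='n] by auto
  obtain D where D: "D > 0" "\<And>f. f \<in> fock_space \<alpha> 1 \<Longrightarrow> (\<integral>\<^sup>+z. ennreal (weighted_modulus \<alpha> f z) \<partial>\<mu>)
      \<le> ennreal (D * fock_norm \<alpha> 1 f) * sup_ball_mass \<mu>"
    using nn_integral_weighted_modulus_le_mass[OF \<alpha>, where 'n='n] sets fin by auto
  obtain s where s: "0 \<le> s" "sup_ball_mass \<mu> = ennreal s"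
    using mass by (cases "sup_ball_mass \<mu>") auto
  show ?thesis
    unfolding fock_carleson_def weighted_modulus_powr
  proof (intro exI[of _ "C powr (q - 1) * D * s"] ballI)
    fix f :: "complex^'n \<Rightarrow> complex" assume f: "f \<in> fock_space \<alpha> 1"
    define N where "N = fock_norm \<alpha> 1 f"
    have N: "0 \<le> N"
      using fock_norm_nonneg[of \<alpha> 1 f] by (simp add: N_def)
    have "(\<integral>\<^sup>+z. ennreal (weighted_modulus \<alpha> f z powr q) \<partial>\<mu>)
        \<le> (\<integral>\<^sup>+z. ennreal ((C * N) powr (q - 1)) * ennreal (weighted_modulus \<alpha> f z) \<partial>\<mu>)"
    proof (rule nn_integral_mono)
      fix z
      have "weighted_modulus \<alpha> f z powr q = weighted_modulus \<alpha> f z powr (q - 1) * weighted_modulus \<alpha> f z powr 1"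
        unfolding powr_add[symmetric] by simp
      also have "\<dots> \<le> (C * N) powr (q - 1) * weighted_modulus \<alpha> f z powr 1"
        using C(2)[OF f, of z] q unfolding N_def by (intro mult_right_mono powr_mono2) auto
      finally show "ennreal (weighted_modulus \<alpha> f z powr q)
          \<le> ennreal ((C * N) powr (q - 1)) * ennreal (weighted_modulus \<alpha> f z)"
        by (simp add: ennreal_leI flip: ennreal_mult)
    qed
    also have "\<dots> = ennreal ((C * N) powr (q - 1)) * (\<integral>\<^sup>+z. ennreal (weighted_modulus \<alpha> f z) \<partial>\<mu>)"
      using entire_imp_measurable[OF fock_space_entire[OF f]] sets
      by (intro nn_integral_cmult) (simp cong: measurable_cong_sets)
    also have "\<dots> \<le> ennreal ((C * N) powr (q - 1)) * (ennreal (D * N) * ennreal s)"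
      using D(2)[OF f] s unfolding N_def by (intro mult_left_mono) auto
    also have "\<dots> = ennreal ((C * N) powr (q - 1) * (D * N * s))"
      using D N s by (simp add: ennreal_mult)
    also have "(C * N) powr (q - 1) * (D * N * s) = C powr (q - 1) * D * s * (N powr (q - 1) * N powr 1)"
      using C N by (simp add: powr_mult)
    also have "N powr (q - 1) * N powr 1 = N powr q"
      unfolding powr_add[symmetric] by simp
    finally show "(\<integral>\<^sup>+z. ennreal (weighted_modulus \<alpha> f z powr q) \<partial>\<mu>)
        \<le> ennreal (C powr (q - 1) * D * s * fock_norm \<alpha> 1 f powr q)"
      by (simp add: N_def)
  qed
qed

lemma finite_mass_of_fock_carleson:
  fixes \<mu> :: "(complex^'n) measure"
  assumes \<alpha>: "0 < \<alpha>" and q: "0 < q" and sets: "sets \<mu> = sets borel" and carleson: "fock_carleson \<alpha> 1 q \<mu>"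
  shows "sup_ball_mass \<mu> < \<infinity>"
proof -
  obtain C where C: "\<And>f. f \<in> fock_space \<alpha> 1 \<Longrightarrow>
      (\<integral>\<^sup>+z. ennreal (weighted_modulus \<alpha> f z powr q) \<partial>\<mu>) \<le> ennreal (C * fock_norm \<alpha> 1 f powr q)"
    using carleson unfolding fock_carleson_def weighted_modulus_powr by blast
  have "berezin \<alpha> q \<mu> w \<le> ennreal C" for w
  proof -
    have "berezin \<alpha> q \<mu> w = (\<integral>\<^sup>+z. ennreal (weighted_modulus \<alpha> (normalized_fock_kernel \<alpha> w) z powr q) \<partial>\<mu>)"
      unfolding berezin_eq weighted_modulus_kernel by (simp add: exp_powr_real mult_ac)
    also have "\<dots> \<le> ennreal C"
      using C[of "normalized_fock_kernel \<alpha> w"] normalized_fock_kernel_norm[OF \<alpha>, of 1 w] by simp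
    finally show ?thesis .
  qed
  from sup_ball_mass_le_berezin[OF \<alpha> q sets this] show ?thesis
    by (auto simp: ennreal_mult_less_top intro: le_less_trans)
qed

lemma Lp_norm_carleson_weighted:
  assumes "f \<in> borel_measurable borel" and sets: "sets \<mu> = sets borel"
  shows "Lp_norm 1 (carleson_weighted \<alpha> 1 \<mu>) f = enn2real (\<integral>\<^sup>+z. ennreal (weighted_modulus \<alpha> f z) \<partial>\<mu>)"
proof -
  have [measurable_cong]: "sets \<mu> = sets borel"
    by (rule sets)
  have [measurable]: "(\<lambda>z. exp (- (1 * \<alpha> / 2) * (norm z)\<^sup>2)) \<in> borel_measurable (borel :: (complex^'a) measure)"
    by (intro borel_measurable_continuous_onI continuous_intros)
  have "(\<integral>\<^sup>+z. ennreal (norm (f z) powr 1) \<partial>carleson_weighted \<alpha> 1 \<mu>)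
      = (\<integral>\<^sup>+z. ennreal (exp (- (1 * \<alpha> / 2) * (norm z)\<^sup>2)) * ennreal (norm (f z) powr 1) \<partial>\<mu>)"
    unfolding carleson_weighted_def using assms(1) by (intro nn_integral_density) measurable
  also have "\<dots> = (\<integral>\<^sup>+z. ennreal (weighted_modulus \<alpha> f z) \<partial>\<mu>)"
    by (simp add: weighted_modulus_def mult.commute flip: ennreal_mult)
  finally show ?thesis
    unfolding Lp_norm_def by simp
qed

text \<open>
  \<open>Lp_norm\<close> takes the value 0 on functions with infinite integral; finiteness of the mass excludes
  this case, so that the real-valued norm agrees with the integral.
\<close>

lemma comparable_embedding_norm:
  assumes \<alpha>: "0 < \<alpha>"
  shows "\<exists>C>0. \<forall>\<mu> :: (complex^'n) measure. sets \<mu> = sets borel \<longrightarrow> sigma_finite_measure \<mu> \<longrightarrow>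
    sup_ball_mass \<mu> < \<infinity> \<longrightarrow> comparable C (embedding_norm \<alpha> 1 1 \<mu>) (sup_ball_mass \<mu>)"
proof -
  obtain C where C: "C > 0" "\<And>\<mu> :: (complex^'n) measure. \<And>f. sets \<mu> = sets borel \<Longrightarrow> sigma_finite_measure \<mu> \<Longrightarrow>
      f \<in> fock_space \<alpha> 1 \<Longrightarrow>
      (\<integral>\<^sup>+z. ennreal (weighted_modulus \<alpha> f z) \<partial>\<mu>) \<le> ennreal (C * fock_norm \<alpha> 1 f) * sup_ball_mass \<mu>"
    using nn_integral_weighted_modulus_le_mass[OF \<alpha>, where 'n='n] by blast
  define e where "e = exp (1 * \<alpha> / 2)"
  show ?thesis
  proof (intro exI[of _ "C + e"] conjI allI impI comparableI)
    fix \<mu> :: "(complex^'n) measure"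
    assume sets: "sets \<mu> = sets borel" and fin: "sigma_finite_measure \<mu>" and mass: "sup_ball_mass \<mu> < \<infinity>"
    have finite: "(\<integral>\<^sup>+z. ennreal (weighted_modulus \<alpha> f z) \<partial>\<mu>) < \<infinity>"
      if "f \<in> fock_space \<alpha> 1" for f :: "complex^'n \<Rightarrow> complex"
      using C(2)[OF sets fin that] mass by (auto simp: ennreal_mult_less_top intro: le_less_trans)
    have Lp: "ennreal (Lp_norm 1 (carleson_weighted \<alpha> 1 \<mu>) f) = (\<integral>\<^sup>+z. ennreal (weighted_modulus \<alpha> f z) \<partial>\<mu>)"
      if "f \<in> fock_space \<alpha> 1" for f :: "complex^'n \<Rightarrow> complex"
      using finite[OF that]
      by (simp add: Lp_norm_carleson_weighted[OF entire_imp_measurable[OF fock_space_entire[OF that]] sets])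
    show "embedding_norm \<alpha> 1 1 \<mu> \<le> ennreal C * sup_ball_mass \<mu>"
      unfolding embedding_norm_def operator_norm_def
    proof (rule SUP_least)
      fix f :: "complex^'n \<Rightarrow> complex" assume "f \<in> {f \<in> fock_space \<alpha> 1. fock_norm \<alpha> 1 f \<le> 1}"
      then have f: "f \<in> fock_space \<alpha> 1" "fock_norm \<alpha> 1 f \<le> 1"
        by auto
      have "ennreal (C * fock_norm \<alpha> 1 f) * sup_ball_mass \<mu> \<le> ennreal C * sup_ball_mass \<mu>"
        using f C(1) by (intro mult_right_mono ennreal_leI mult_left_le) auto
      then show "ennreal (Lp_norm 1 (carleson_weighted \<alpha> 1 \<mu>) f) \<le> ennreal C * sup_ball_mass \<mu>"
        unfolding Lp[OF f(1)] using C(2)[OF sets fin f(1)] by (rule order_trans[rotated])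
    qed
    show "sup_ball_mass \<mu> \<le> ennreal e * embedding_norm \<alpha> 1 1 \<mu>"
      unfolding e_def
    proof (rule sup_ball_mass_le_berezin[OF \<alpha> _ sets])
      fix w :: "complex^'n"
      have k: "normalized_fock_kernel \<alpha> w \<in> fock_space \<alpha> 1" "fock_norm \<alpha> 1 (normalized_fock_kernel \<alpha> w) = 1"
        using normalized_fock_kernel_norm[OF \<alpha>, of 1 w] by simp_all
      have "berezin \<alpha> 1 \<mu> w = ennreal (Lp_norm 1 (carleson_weighted \<alpha> 1 \<mu>) (normalized_fock_kernel \<alpha> w))"
        unfolding Lp[OF k(1)] weighted_modulus_kernel berezin_eq by simp
      also have "\<dots> \<le> embedding_norm \<alpha> 1 1 \<mu>"
        unfolding embedding_norm_def operator_norm_def using k by (intro SUP_upper) auto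
      finally show "berezin \<alpha> 1 \<mu> w \<le> embedding_norm \<alpha> 1 1 \<mu>" .
    qed simp
  qed (use C in \<open>auto simp: e_def add_pos_pos\<close>)
qed

section \<open>Equivalence of the boundedness conditions\<close>

theorem corollary2p3:
  fixes \<alpha> p :: real and lat :: "real \<Rightarrow> nat \<Rightarrow> complex^'n"
  assumes alpha: "\<alpha> > 0"
    and p: "1 \<le> p"
    and lattice: "\<And>r. r > 0 \<Longrightarrow> half_lattice r (lat r)"
  shows "(\<forall>\<mu> :: (complex^'n) measure. sets \<mu> = sets borel \<longrightarrow> admissible \<alpha> \<mu> \<longrightarrow>
      (toeplitz_bounded \<alpha> (ennreal p) \<infinity> \<mu> \<longleftrightarrow> (\<exists>q\<ge>p. fock_carleson \<alpha> 1 q \<mu>)) \<and>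
      (toeplitz_bounded \<alpha> (ennreal p) \<infinity> \<mu> \<longleftrightarrow> (\<forall>q\<ge>p. fock_carleson \<alpha> 1 q \<mu>)) \<and>
      (toeplitz_bounded \<alpha> (ennreal p) \<infinity> \<mu> \<longleftrightarrow>
         (\<exists>\<delta>>0. Linf_norm (\<lambda>z. emeasure \<mu> (ball z \<delta>)) < \<infinity>)) \<and>
      (toeplitz_bounded \<alpha> (ennreal p) \<infinity> \<mu> \<longleftrightarrow>
         (\<forall>\<delta>>0. Linf_norm (\<lambda>z. emeasure \<mu> (ball z \<delta>)) < \<infinity>)) \<and>
      (toeplitz_bounded \<alpha> (ennreal p) \<infinity> \<mu> \<longleftrightarrow> (\<exists>t>0. Linf_norm (berezin \<alpha> t \<mu>) < \<infinity>)) \<and>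
      (toeplitz_bounded \<alpha> (ennreal p) \<infinity> \<mu> \<longleftrightarrow> (\<forall>t>0. Linf_norm (berezin \<alpha> t \<mu>) < \<infinity>)) \<and>
      (toeplitz_bounded \<alpha> (ennreal p) \<infinity> \<mu> \<longleftrightarrow>
         (\<exists>r>0. linf_norm (\<lambda>k. emeasure \<mu> (ball (lat r k) r)) < \<infinity>)) \<and>
      (toeplitz_bounded \<alpha> (ennreal p) \<infinity> \<mu> \<longleftrightarrow>
         (\<forall>r>0. linf_norm (\<lambda>k. emeasure \<mu> (ball (lat r k) r)) < \<infinity>))) \<and>
    (\<forall>t>0. \<forall>\<delta>>0. \<forall>r>0. \<exists>C>0. \<forall>\<mu> :: (complex^'n) measure.
      sets \<mu> = sets borel \<longrightarrow> admissible \<alpha> \<mu> \<longrightarrow> toeplitz_bounded \<alpha> (ennreal p) \<infinity> \<mu> \<longrightarrow>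
        comparable C (toeplitz_norm \<alpha> (ennreal p) \<infinity> \<mu>) (embedding_norm \<alpha> 1 1 \<mu>) \<and>
        comparable C (embedding_norm \<alpha> 1 1 \<mu>) (Linf_norm (berezin \<alpha> t \<mu>)) \<and>
        comparable C (Linf_norm (berezin \<alpha> t \<mu>)) (Linf_norm (\<lambda>z. emeasure \<mu> (ball z \<delta>))) \<and>
        comparable C (Linf_norm (\<lambda>z. emeasure \<mu> (ball z \<delta>)))
                     (linf_norm (\<lambda>k. emeasure \<mu> (ball (lat r k) r))))"
proof (intro conjI allI impI)
  fix \<mu> :: "(complex^'n) measure"
  assume sets: "sets \<mu> = sets borel" and adm: "admissible \<alpha> \<mu>"
  note fin = admissible_imp_sigma_finite[OF adm alpha sets]
  let ?T = "toeplitz_bounded \<alpha> (ennreal p) \<infinity> \<mu>"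
  have T: "?T \<longleftrightarrow> sup_ball_mass \<mu> < \<infinity>"
    using comparable_toeplitz_norm[OF alpha p, where 'n='n] sets fin by blast
  have carleson: "?T \<longleftrightarrow> fock_carleson \<alpha> 1 q \<mu>" if "p \<le> q" for q
    using fock_carleson_of_finite_mass[OF alpha _ sets fin, of q]
      finite_mass_of_fock_carleson[OF alpha _ sets, of q] that p unfolding T by auto
  have ball: "?T \<longleftrightarrow> Linf_norm (\<lambda>z. emeasure \<mu> (ball z \<delta>)) < \<infinity>" if "0 < \<delta>" for \<delta>
    using comparable_Linf_norm_emeasure_ball[OF that, where 'n='n] sets fin comparable_finite_iff unfolding T by blast
  have berezin: "?T \<longleftrightarrow> Linf_norm (berezin \<alpha> t \<mu>) < \<infinity>" if "0 < t" for t
    using comparable_Linf_norm_berezin[OF alpha that, where 'n='n] sets fin comparable_finite_iff unfolding T by blast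
  have lat: "?T \<longleftrightarrow> linf_norm (\<lambda>k. emeasure \<mu> (ball (lat r k) r)) < \<infinity>" if "0 < r" for r
    using comparable_linf_norm_lattice[OF that lattice[OF that]] sets fin comparable_finite_iff unfolding T by blast
  show "?T \<longleftrightarrow> (\<exists>q\<ge>p. fock_carleson \<alpha> 1 q \<mu>)" "?T \<longleftrightarrow> (\<forall>q\<ge>p. fock_carleson \<alpha> 1 q \<mu>)"
    using carleson by blast+
  show "?T \<longleftrightarrow> (\<exists>\<delta>>0. Linf_norm (\<lambda>z. emeasure \<mu> (ball z \<delta>)) < \<infinity>)"
    "?T \<longleftrightarrow> (\<forall>\<delta>>0. Linf_norm (\<lambda>z. emeasure \<mu> (ball z \<delta>)) < \<infinity>)"
    using ball zero_less_one by blast+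
  show "?T \<longleftrightarrow> (\<exists>t>0. Linf_norm (berezin \<alpha> t \<mu>) < \<infinity>)" "?T \<longleftrightarrow> (\<forall>t>0. Linf_norm (berezin \<alpha> t \<mu>) < \<infinity>)"
    using berezin zero_less_one by blast+
  show "?T \<longleftrightarrow> (\<exists>r>0. linf_norm (\<lambda>k. emeasure \<mu> (ball (lat r k) r)) < \<infinity>)"
    "?T \<longleftrightarrow> (\<forall>r>0. linf_norm (\<lambda>k. emeasure \<mu> (ball (lat r k) r)) < \<infinity>)"
    using lat zero_less_one by blast+
next
  fix t \<delta> r :: real
  assume t: "0 < t" and \<delta>: "0 < \<delta>" and r: "0 < r"
  let ?T = "\<lambda>\<mu> :: (complex^'n) measure. toeplitz_bounded \<alpha> (ennreal p) \<infinity> \<mu>"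
  obtain C\<^sub>1 where C\<^sub>1: "0 < C\<^sub>1" "\<And>\<mu> :: (complex^'n) measure. sets \<mu> = sets borel \<Longrightarrow> sigma_finite_measure \<mu> \<Longrightarrow>
      (?T \<mu> \<longleftrightarrow> sup_ball_mass \<mu> < \<infinity>) \<and> (?T \<mu> \<longrightarrow> comparable C\<^sub>1 (toeplitz_norm \<alpha> (ennreal p) \<infinity> \<mu>) (sup_ball_mass \<mu>))"
    using comparable_toeplitz_norm[OF alpha p, where 'n='n] by blast
  obtain C\<^sub>2 where C\<^sub>2: "0 < C\<^sub>2" "\<And>\<mu> :: (complex^'n) measure. sets \<mu> = sets borel \<Longrightarrow> sigma_finite_measure \<mu> \<Longrightarrow>
      sup_ball_mass \<mu> < \<infinity> \<Longrightarrow> comparable C\<^sub>2 (embedding_norm \<alpha> 1 1 \<mu>) (sup_ball_mass \<mu>)"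
    using comparable_embedding_norm[OF alpha, where 'n='n] by blast
  obtain C\<^sub>3 where C\<^sub>3: "0 < C\<^sub>3" "\<And>\<mu> :: (complex^'n) measure. sets \<mu> = sets borel \<Longrightarrow> sigma_finite_measure \<mu> \<Longrightarrow>
      comparable C\<^sub>3 (Linf_norm (berezin \<alpha> t \<mu>)) (sup_ball_mass \<mu>)"
    using comparable_Linf_norm_berezin[OF alpha t, where 'n='n] by blast
  obtain C\<^sub>4 where C\<^sub>4: "0 < C\<^sub>4" "\<And>\<mu> :: (complex^'n) measure. sets \<mu> = sets borel \<Longrightarrow> sigma_finite_measure \<mu> \<Longrightarrow>
      comparable C\<^sub>4 (Linf_norm (\<lambda>z. emeasure \<mu> (ball z \<delta>))) (sup_ball_mass \<mu>)"
    using comparable_Linf_norm_emeasure_ball[OF \<delta>, where 'n='n] by blast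
  obtain C\<^sub>5 where C\<^sub>5: "0 < C\<^sub>5" "\<And>\<mu> :: (complex^'n) measure. sets \<mu> = sets borel \<Longrightarrow> sigma_finite_measure \<mu> \<Longrightarrow>
      comparable C\<^sub>5 (linf_norm (\<lambda>k. emeasure \<mu> (ball (lat r k) r))) (sup_ball_mass \<mu>)"
    using comparable_linf_norm_lattice[OF r lattice[OF r]] by blast
  define C where "C = Max {C\<^sub>1, C\<^sub>2, C\<^sub>3, C\<^sub>4, C\<^sub>5}"
  have le_C: "C\<^sub>1 \<le> C" "C\<^sub>2 \<le> C" "C\<^sub>3 \<le> C" "C\<^sub>4 \<le> C" "C\<^sub>5 \<le> C"
    by (simp_all add: C_def)
  then have C: "0 < C"
    using C\<^sub>1(1) by linarith
  note link = comparable_trans[OF _ comparable_sym C C]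
  show "\<exists>C>0. \<forall>\<mu> :: (complex^'n) measure.
      sets \<mu> = sets borel \<longrightarrow> admissible \<alpha> \<mu> \<longrightarrow> toeplitz_bounded \<alpha> (ennreal p) \<infinity> \<mu> \<longrightarrow>
        comparable C (toeplitz_norm \<alpha> (ennreal p) \<infinity> \<mu>) (embedding_norm \<alpha> 1 1 \<mu>) \<and>
        comparable C (embedding_norm \<alpha> 1 1 \<mu>) (Linf_norm (berezin \<alpha> t \<mu>)) \<and>
        comparable C (Linf_norm (berezin \<alpha> t \<mu>)) (Linf_norm (\<lambda>z. emeasure \<mu> (ball z \<delta>))) \<and>
        comparable C (Linf_norm (\<lambda>z. emeasure \<mu> (ball z \<delta>)))
                     (linf_norm (\<lambda>k. emeasure \<mu> (ball (lat r k) r)))"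
  \<comment> \<open>Two of the quantities are compared through \<open>sup_ball_mass\<close>, and each of the two steps costs a
    factor \<open>C\<close>.\<close>
  proof (rule exI[of _ "C * C"], rule conjI, use C in simp, intro allI impI)
    fix \<mu> :: "(complex^'n) measure"
    assume sets: "sets \<mu> = sets borel" and adm: "admissible \<alpha> \<mu>" and T: "toeplitz_bounded \<alpha> (ennreal p) \<infinity> \<mu>"
    note \<mu> = sets admissible_imp_sigma_finite[OF adm alpha sets]
    have mass: "sup_ball_mass \<mu> < \<infinity>"
      using C\<^sub>1(2)[OF \<mu>] T by blast
    have "comparable C (toeplitz_norm \<alpha> (ennreal p) \<infinity> \<mu>) (sup_ball_mass \<mu>)"
      using C\<^sub>1(2)[OF \<mu>] T comparable_mono[OF le_C(1)] by blast
    moreover have "comparable C (embedding_norm \<alpha> 1 1 \<mu>) (sup_ball_mass \<mu>)"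
      by (rule comparable_mono[OF le_C(2) C\<^sub>2(2)[OF \<mu> mass]])
    moreover have "comparable C (Linf_norm (berezin \<alpha> t \<mu>)) (sup_ball_mass \<mu>)"
      by (rule comparable_mono[OF le_C(3) C\<^sub>3(2)[OF \<mu>]])
    moreover have "comparable C (Linf_norm (\<lambda>z. emeasure \<mu> (ball z \<delta>))) (sup_ball_mass \<mu>)"
      by (rule comparable_mono[OF le_C(4) C\<^sub>4(2)[OF \<mu>]])
    moreover have "comparable C (linf_norm (\<lambda>k. emeasure \<mu> (ball (lat r k) r))) (sup_ball_mass \<mu>)"
      by (rule comparable_mono[OF le_C(5) C\<^sub>5(2)[OF \<mu>]])
    ultimately show "comparable (C * C) (toeplitz_norm \<alpha> (ennreal p) \<infinity> \<mu>) (embedding_norm \<alpha> 1 1 \<mu>) \<and>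
        comparable (C * C) (embedding_norm \<alpha> 1 1 \<mu>) (Linf_norm (berezin \<alpha> t \<mu>)) \<and>
        comparable (C * C) (Linf_norm (berezin \<alpha> t \<mu>)) (Linf_norm (\<lambda>z. emeasure \<mu> (ball z \<delta>))) \<and>
        comparable (C * C) (Linf_norm (\<lambda>z. emeasure \<mu> (ball z \<delta>)))
                     (linf_norm (\<lambda>k. emeasure \<mu> (ball (lat r k) r)))"
      by (intro conjI link)
  qed
qed

end
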